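(* Let $\mathbb{K}\in\{\mathbb{R},\mathbb{C}\}$ and let $m\geq 1$ be an integer. Then $$\lambda_\mathbb{K}(m)=\mu_\mathbb{K}(m).$$
   Context: For a Banach space $X$ over $\mathbb{K}$ and a finite-dimensional subspace $Y\subset X$, let $\mathcal{P}(X,Y)$ be the set of bounded linear projections from $X$ onto $Y$ (i.e. bounded linear $P:X\to Y$ with $P|_Y=\mathrm{Id}_Y$). The relative projection constant is $\lambda_\mathbb{K}(Y,X)=\inf\{\|P\|:P\in\mathcal{P}(X,Y)\}$, the absolute projection constant is $\lambda_\mathbb{K}(Y)=\sup\{\lambda_\mathbb{K}(Y,X): Y\subset X\}$ (supremum over all Banach spaces $X$ over $\mathbb{K}$ containing $Y$ isometrically), and the maximal absolute projection constant is $\lambda_\mathbb{K}(m)=\sup\{\lambda_\mathbb{K}(Y):\dim Y=m\}$. For integers $N\geq m$, the quasimaximal relative projection constant is $$\mu_\mathbb{K}(m,N)=\max\Big\{\tfrac{1}{N}\sum_{i,j=1}^N |(U^*U)_{ij}| : U\in\mathbb{K}^{m\times N},\ UU^*=\mathrm{I}_m\Big\},$$ and the quasimaximal absolute projection constant is $\mu_\mathbb{K}(m)=\sup\{\mu_\mathbb{K}(m,N):N\geq m\}$. *)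

theory Defs
  imports Complex_Main
begin

text \<open>Explicit normed spaces over a scalar field 'k (used with 'k = real and 'k = complex,
  since Isabelle/HOL has no type class of complex vector spaces). A space is given by
  a carrier set together with addition, zero, scalar multiplication and norm.\<close>

record ('v, 'k) nspace =
  ns_carrier :: "'v set"
  ns_add :: "'v \<Rightarrow> 'v \<Rightarrow> 'v"
  ns_zero :: 'v
  ns_smult :: "'k \<Rightarrow> 'v \<Rightarrow> 'v"
  ns_norm :: "'v \<Rightarrow> real"

definition ns_diff :: "('v, 'k::real_normed_field) nspace \<Rightarrow> 'v \<Rightarrow> 'v \<Rightarrow> 'v" where
  "ns_diff X x y = ns_add X x (ns_smult X (-1) y)"

definition is_banach :: "('v, 'k::real_normed_field) nspace \<Rightarrow> bool" where
  "is_banach X \<longleftrightarrow>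
    (let V = ns_carrier X; add = ns_add X; z = ns_zero X; sm = ns_smult X; nm = ns_norm X in
      z \<in> V \<and>
      (\<forall>x\<in>V. \<forall>y\<in>V. add x y \<in> V) \<and>
      (\<forall>a. \<forall>x\<in>V. sm a x \<in> V) \<and>
      (\<forall>x\<in>V. \<forall>y\<in>V. \<forall>w\<in>V. add (add x y) w = add x (add y w)) \<and>
      (\<forall>x\<in>V. \<forall>y\<in>V. add x y = add y x) \<and>
      (\<forall>x\<in>V. add x z = x) \<and>
      (\<forall>x\<in>V. add x (sm (-1) x) = z) \<and>
      (\<forall>x\<in>V. sm 1 x = x) \<and>
      (\<forall>a b. \<forall>x\<in>V. sm a (sm b x) = sm (a * b) x) \<and>
      (\<forall>a b. \<forall>x\<in>V. sm (a + b) x = add (sm a x) (sm b x)) \<and>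
      (\<forall>a. \<forall>x\<in>V. \<forall>y\<in>V. sm a (add x y) = add (sm a x) (sm a y)) \<and>
      (\<forall>x\<in>V. nm x \<ge> 0) \<and>
      (\<forall>x\<in>V. nm x = 0 \<longleftrightarrow> x = z) \<and>
      (\<forall>a. \<forall>x\<in>V. nm (sm a x) = norm a * nm x) \<and>
      (\<forall>x\<in>V. \<forall>y\<in>V. nm (add x y) \<le> nm x + nm y) \<and>
      (\<forall>s::nat \<Rightarrow> 'v. (\<forall>n. s n \<in> V) \<and>
          (\<forall>e>0. \<exists>N. \<forall>p\<ge>N. \<forall>q\<ge>N. nm (ns_diff X (s p) (s q)) < e) \<longrightarrow>
          (\<exists>l\<in>V. \<forall>e>0. \<exists>N. \<forall>n\<ge>N. nm (ns_diff X (s n) l) < e)))"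

primrec lincomb :: "('v, 'k::real_normed_field) nspace \<Rightarrow> (nat \<Rightarrow> 'k) \<Rightarrow> (nat \<Rightarrow> 'v) \<Rightarrow> nat \<Rightarrow> 'v" where
  "lincomb X c b 0 = ns_zero X"
| "lincomb X c b (Suc n) = ns_add X (lincomb X c b n) (ns_smult X (c n) (b n))"

definition fin_subspace :: "('v, 'k::real_normed_field) nspace \<Rightarrow> 'v set \<Rightarrow> nat \<Rightarrow> bool" where
  "fin_subspace X Y m \<longleftrightarrow>
    (\<exists>b::nat \<Rightarrow> 'v. (\<forall>i<m. b i \<in> ns_carrier X) \<and>
       (\<forall>c. lincomb X c b m = ns_zero X \<longrightarrow> (\<forall>i<m. c i = 0)) \<and>
       Y = {lincomb X c b m | c. True})"

definition is_proj :: "('v, 'k::real_normed_field) nspace \<Rightarrow> 'v set \<Rightarrow> ('v \<Rightarrow> 'v) \<Rightarrow> bool" where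
  "is_proj X Y P \<longleftrightarrow>
    (\<forall>x\<in>ns_carrier X. P x \<in> Y) \<and>
    (\<forall>x\<in>ns_carrier X. \<forall>y\<in>ns_carrier X. P (ns_add X x y) = ns_add X (P x) (P y)) \<and>
    (\<forall>a. \<forall>x\<in>ns_carrier X. P (ns_smult X a x) = ns_smult X a (P x)) \<and>
    (\<exists>C. \<forall>x\<in>ns_carrier X. ns_norm X (P x) \<le> C * ns_norm X x) \<and>
    (\<forall>y\<in>Y. P y = y)"

definition op_norm :: "('v, 'k::real_normed_field) nspace \<Rightarrow> ('v \<Rightarrow> 'v) \<Rightarrow> real" where
  "op_norm X P = Sup {ns_norm X (P x) | x. x \<in> ns_carrier X \<and> ns_norm X x \<le> 1}"

definition rel_proj_const :: "('v, 'k::real_normed_field) nspace \<Rightarrow> 'v set \<Rightarrow> real" where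
  "rel_proj_const X Y = Inf (op_norm X ` {P. is_proj X Y P})"

text \<open>Quasimaximal relative projection constant mu(m,N); cj is the conjugation of the
  scalar field (id for real, cnj for complex). U is an m x N matrix (entries U k j, k<m, j<N).\<close>
definition mu_rel :: "('k::real_normed_field \<Rightarrow> 'k) \<Rightarrow> nat \<Rightarrow> nat \<Rightarrow> real" where
  "mu_rel cj m N = Sup {(1 / real N) * (\<Sum>i<N. \<Sum>j<N. norm (\<Sum>k<m. cj (U k i) * U k j)) | U.
       \<forall>a<m. \<forall>b<m. (\<Sum>j<N. U a j * cj (U b j)) = (if a = b then 1 else 0)}"

definition mu_abs :: "('k::real_normed_field \<Rightarrow> 'k) \<Rightarrow> nat \<Rightarrow> real" where
  "mu_abs cj m = Sup {mu_rel cj m N | N. N \<ge> m}"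

end

theory Submission
  imports Defs "HOL-Analysis.Analysis"
begin

text \<open>
  Upper bound.  Finitely many norming functionals embed \<open>Y\<close> almost isometrically into
  \<open>\<ell>\<^sub>\<infinity>\<^sup>N\<close>; by Hahn--Banach they live on all of \<open>X\<close>, so it suffices to find a projection matrix whose
  row sums are all at most \<open>\<mu>(m) + \<epsilon>\<close>.  By a minimax argument one only has to bound a weighted mean of the
  row sums, for integer weights \<open>n\<^sub>j \<ge> 1\<close>.  There the orthogonal projection of weighted \<open>\<ell>\<^sub>2\<close> works:
  repeating the \<open>j\<close>-th coordinate \<open>n\<^sub>j\<close> times exhibits the weighted mean as a value
  \<open>1/N \<Sum> |(U\<^sup>*U)\<^sub>i\<^sub>j|\<close>.

  Lower bound.  Given \<open>U\<close>, let \<open>B\<close> be the Hermitian matrix of conjugate signs of \<open>U\<^sup>*U\<close>, so that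
  \<open>tr (U B U\<^sup>*)\<close> is the sum of the \<open>|(U\<^sup>*U)\<^sub>i\<^sub>j|\<close>.  An orthonormal frame \<open>V\<close> maximising \<open>tr (V B V\<^sup>*)\<close> spans a
  \<open>B\<close>-invariant subspace \<open>Y\<close>.  Hence \<open>tr (P B) = tr (B|\<^sub>Y)\<close> for every projection \<open>P\<close> of
  \<open>\<ell>\<^sub>\<infinity>\<^sup>N\<close> onto \<open>Y\<close>, while \<open>|tr (P B)| \<le> N \<parallel>P\<parallel>\<close> because the entries of \<open>B\<close> are bounded by 1.
\<close>

section \<open>Separation in real vector spaces on a carrier set\<close>

text \<open>A norm on a sup-norm space is governed by the largest row sum, whereas
  \<open>mu_abs\<close> controls only averages over unweighted coordinates. Separation produces real
  weights, possibly zero; repetition of coordinates realises only integers, and the weighted inner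
  product must be definite. Hence the weights are scaled by a large \<open>T\<close> and rounded up
  to positive integers, and the rounding error, at most 2 per coordinate, is absorbed by the slack
  \<open>T * e\<close>. The unit ball of \<open>Y\<close> need not be a polytope, so finitely many
  functionals recover its norm only up to a factor \<open>1 - e\<close>; both losses vanish as
  \<open>e\<close> tends to 0. In the lower bound the row space of the given \<open>U\<close> need
  not be invariant under \<open>B\<close>, and without invariance the trace of \<open>P B\<close>
  may depend on \<open>P\<close>. Passing to a maximiser cures this at no cost, since the trace can
  only grow; the maximum exists because the frames form a compact set.\<close>

locale real_carrier_space =
  fixes V :: "'v set" and add :: "'v \<Rightarrow> 'v \<Rightarrow> 'v" and z :: 'v and sm :: "real \<Rightarrow> 'v \<Rightarrow> 'v"
  assumes z_in: "z \<in> V"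
    and add_in: "\<lbrakk>x \<in> V; y \<in> V\<rbrakk> \<Longrightarrow> add x y \<in> V"
    and sm_in: "x \<in> V \<Longrightarrow> sm r x \<in> V"
    and assoc: "\<lbrakk>x \<in> V; y \<in> V; u \<in> V\<rbrakk> \<Longrightarrow> add (add x y) u = add x (add y u)"
    and comm: "\<lbrakk>x \<in> V; y \<in> V\<rbrakk> \<Longrightarrow> add x y = add y x"
    and add_z: "x \<in> V \<Longrightarrow> add x z = x"
    and sm_one: "x \<in> V \<Longrightarrow> sm 1 x = x"
    and sm_zero: "x \<in> V \<Longrightarrow> sm 0 x = z"
    and sm_sm: "x \<in> V \<Longrightarrow> sm r (sm s x) = sm (r * s) x"
    and sm_add_left: "x \<in> V \<Longrightarrow> sm (r + s) x = add (sm r x) (sm s x)"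
    and sm_add_right: "\<lbrakk>x \<in> V; y \<in> V\<rbrakk> \<Longrightarrow> sm r (add x y) = add (sm r x) (sm r y)"
begin

lemma add_interchange:
  assumes "a \<in> V" "b \<in> V" "c \<in> V" "d \<in> V"
  shows "add (add a b) (add c d) = add (add a c) (add b d)"
proof -
  have "add (add a b) (add c d) = add a (add (add b c) d)"
    using assms by (simp add: assoc add_in)
  also have "\<dots> = add a (add (add c b) d)" using assms by (simp add: comm)
  also have "\<dots> = add (add a c) (add b d)" using assms by (simp add: assoc add_in)
  finally show ?thesis .
qed

lemma sm_z: "sm r z = z"
  using sm_sm[OF z_in, of r 0] sm_zero[OF z_in] by simp

lemma add_neg: "x \<in> V \<Longrightarrow> add x (sm (-1) x) = z"
  using sm_add_left[of x 1 "-1"] by (simp add: sm_one sm_zero)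

text \<open>A Hahn--Banach theorem in the form of Mazur and Orlicz.  Zorn's lemma is applied to convex cones
  in \<open>V \<times> \<real>\<close> avoiding \<open>(0, -1)\<close>; a maximal one is a half-space, the epigraph of the functional.\<close>

theorem mazur_orlicz:
  fixes p :: "'v \<Rightarrow> real" and \<beta> :: real
  assumes p_add: "\<And>x y. \<lbrakk>x \<in> V; y \<in> V\<rbrakk> \<Longrightarrow> p (add x y) \<le> p x + p y"
    and p_sm: "\<And>s x. \<lbrakk>s \<ge> 0; x \<in> V\<rbrakk> \<Longrightarrow> p (sm s x) = s * p x"
    and C: "C \<subseteq> V" "C \<noteq> {}"
    and conv: "\<And>c d s t. \<lbrakk>c \<in> C; d \<in> C; s \<ge> 0; t \<ge> 0; s + t = 1\<rbrakk> \<Longrightarrow> add (sm s c) (sm t d) \<in> C"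
    and beta: "\<And>c. c \<in> C \<Longrightarrow> \<beta> \<le> p c"
  shows "\<exists>w :: 'v \<Rightarrow> real. (\<forall>x\<in>V. \<forall>y\<in>V. w (add x y) = w x + w y) \<and>
    (\<forall>r. \<forall>x\<in>V. w (sm r x) = r * w x) \<and> (\<forall>x\<in>V. w x \<le> p x) \<and> (\<forall>c\<in>C. \<beta> \<le> w c)"
proof -
  \<comment> \<open>Up to boundary points, this is the epigraph of the auxiliary sublinear
    functional \<open>x \<mapsto> inf (p (x + s c) - s \<beta>)\<close> over
    \<open>s \<ge> 0\<close> and \<open>c \<in> C\<close>. Taking \<open>s = 0\<close> gives the
    points above \<open>p\<close>; taking \<open>s = 1\<close> gives \<open>(-c, -\<beta>)\<close>,
    which later forces \<open>w c \<ge> \<beta>\<close>.\<close>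
  define E0 where "E0 = {(x, r). x \<in> V \<and> (\<exists>s\<ge>0. \<exists>c\<in>C. p (add x (sm s c)) - s * \<beta> \<le> r)}"
  define good where "good E \<longleftrightarrow> E0 \<subseteq> E \<and> E \<subseteq> V \<times> UNIV \<and>
     (\<forall>x r y q. (x, r) \<in> E \<longrightarrow> (y, q) \<in> E \<longrightarrow> (add x y, r + q) \<in> E) \<and>
     (\<forall>s>0. \<forall>x r. (x, r) \<in> E \<longrightarrow> (sm s x, s * r) \<in> E) \<and> (z, -1) \<notin> E" for E
  have pz: "p z = 0" using p_sm[of 0 z] sm_z z_in by simp
  obtain c0 where c0: "c0 \<in> C" using C by blast
  have E0I: "(x, r) \<in> E0" if "x \<in> V" "s \<ge> 0" "c \<in> C" "p (add x (sm s c)) - s * \<beta> \<le> r" for x r s c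
    unfolding E0_def using that by blast
  have E0p: "(x, r) \<in> E0" if "x \<in> V" "p x \<le> r" for x r
  proof -
    have "c0 \<in> V" using c0 C by blast
    hence "p (add x (sm 0 c0)) - 0 * \<beta> \<le> r" using that by (simp add: sm_zero add_z)
    thus ?thesis using that(1) c0 by (intro E0I[of x 0 c0]) auto
  qed
  have "good E0"
    unfolding good_def
  proof (intro conjI allI impI)
    show "E0 \<subseteq> E0" ..
    show "E0 \<subseteq> V \<times> UNIV" by (auto simp: E0_def)
    fix x r y q assume "(x, r) \<in> E0" "(y, q) \<in> E0"
    then obtain s c t d where x: "x \<in> V" "s \<ge> 0" "c \<in> C" "p (add x (sm s c)) - s * \<beta> \<le> r"
      and y: "y \<in> V" "t \<ge> 0" "d \<in> C" "p (add y (sm t d)) - t * \<beta> \<le> q" by (auto simp: E0_def)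
    have V: "c \<in> V" "d \<in> V" using x y C by auto
    \<comment> \<open>\<open>C\<close> is convex but need not be a cone, so the sum is rewritten as
      \<open>s + t\<close> times a convex combination; if both scalars vanish, any point of
      \<open>C\<close> serves.\<close>
    obtain e where e: "e \<in> C" "sm (s + t) e = add (sm s c) (sm t d)"
    proof (cases "s + t = 0")
      case True
      hence "s = 0" "t = 0" using x y by auto
      thus ?thesis using that[of c] x V by (simp add: sm_zero add_z z_in)
    next
      case False
      define u where "u = s + t"
      have u: "u > 0" using False x y u_def by auto
      have su: "s / u + t / u = 1" using u by (simp add: u_def add_divide_distrib[symmetric])
      show ?thesis
      proof (rule that)
        show "add (sm (s / u) c) (sm (t / u) d) \<in> C"
          using x y u su by (intro conv) auto
        show "sm (s + t) (add (sm (s / u) c) (sm (t / u) d)) = add (sm s c) (sm t d)"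
          using u V by (simp add: sm_add_right sm_in sm_sm u_def[symmetric])
      qed
    qed
    have "add (add x y) (sm (s + t) e) = add (add x (sm s c)) (add y (sm t d))"
      unfolding e(2) using x y V by (intro add_interchange) (auto intro: sm_in)
    hence "p (add (add x y) (sm (s + t) e)) \<le> p (add x (sm s c)) + p (add y (sm t d))"
      using x y V by (simp add: p_add add_in sm_in)
    hence "p (add (add x y) (sm (s + t) e)) - (s + t) * \<beta> \<le> r + q"
      using x y by (simp add: algebra_simps)
    thus "(add x y, r + q) \<in> E0"
      using x(1,2) y(1,2) e(1) by (intro E0I[of _ "s + t" e]) (auto intro: add_in)
  next
    fix s x r assume s: "(s::real) > 0" and "(x, r) \<in> E0"
    then obtain t c where x: "x \<in> V" "t \<ge> 0" "c \<in> C" "p (add x (sm t c)) - t * \<beta> \<le> r"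
      by (auto simp: E0_def)
    have V: "c \<in> V" using x C by auto
    have "add (sm s x) (sm (s * t) c) = sm s (add x (sm t c))"
      using x V by (simp add: sm_add_right sm_in sm_sm)
    hence "p (add (sm s x) (sm (s * t) c)) = s * p (add x (sm t c))"
      using s x V by (simp add: p_sm add_in sm_in)
    hence "p (add (sm s x) (sm (s * t) c)) - (s * t) * \<beta> = s * (p (add x (sm t c)) - t * \<beta>)"
      by (simp add: algebra_simps)
    also have "\<dots> \<le> s * r" using x s by (intro mult_left_mono) auto
    finally show "(sm s x, s * r) \<in> E0"
      using x s by (intro E0I[of _ "s * t" c]) (auto intro: sm_in)
  next
    show "(z, -1) \<notin> E0"
    proof
      assume "(z, -1) \<in> E0"
      then obtain s c where x: "s \<ge> 0" "c \<in> C" "p (add z (sm s c)) - s * \<beta> \<le> -1"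
        by (auto simp: E0_def)
      have V: "c \<in> V" using x C by auto
      have "p (add z (sm s c)) = s * p c" using x V by (simp add: comm[of z] sm_in z_in add_z p_sm)
      moreover have "s * \<beta> \<le> s * p c" using x beta by (intro mult_left_mono) auto
      ultimately show False using x by linarith
    qed
  qed
  have "\<exists>M\<in>{E. good E}. \<forall>X\<in>{E. good E}. M \<subseteq> X \<longrightarrow> X = M"
  proof (rule subset_Zorn_nonempty)
    show "{E. good E} \<noteq> {}" using \<open>good E0\<close> by blast
    fix \<C> assume ne: "\<C> \<noteq> {}" and ch: "subset.chain {E. good E} \<C>"
    have g: "good E" if "E \<in> \<C>" for E using ch that by (auto simp: subset_chain_def)
    have tot: "A \<subseteq> B \<or> B \<subseteq> A" if "A \<in> \<C>" "B \<in> \<C>" for A B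
      using ch that by (auto simp: subset_chain_def)
    have "good (\<Union>\<C>)"
      unfolding good_def
    proof (intro conjI allI impI)
      have g': "E0 \<subseteq> E" "E \<subseteq> V \<times> UNIV" if "E \<in> \<C>" for E
        using g[OF that] unfolding good_def by blast+
      show "E0 \<subseteq> \<Union>\<C>" using ne g' by blast
      show "\<Union>\<C> \<subseteq> V \<times> UNIV" using g' by blast
      fix x r y q assume "(x, r) \<in> \<Union>\<C>" "(y, q) \<in> \<Union>\<C>"
      then obtain A B where AB: "A \<in> \<C>" "B \<in> \<C>" "(x, r) \<in> A" "(y, q) \<in> B" by blast
      then obtain D where D: "D \<in> \<C>" "(x, r) \<in> D" "(y, q) \<in> D" using tot[of A B] by blast
      thus "(add x y, r + q) \<in> \<Union>\<C>" using g[OF D(1)] unfolding good_def by blast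
    next
      fix s x r assume "(s::real) > 0" "(x, r) \<in> \<Union>\<C>"
      thus "(sm s x, s * r) \<in> \<Union>\<C>" using g unfolding good_def by blast
    next
      show "(z, -1) \<notin> \<Union>\<C>" using g unfolding good_def by blast
    qed
    thus "\<Union>\<C> \<in> {E. good E}" by simp
  qed
  then obtain E where E: "good E" and maxE: "\<And>X. good X \<Longrightarrow> E \<subseteq> X \<Longrightarrow> X = E" by blast
  have E_add: "(add x y, r + q) \<in> E" if "(x, r) \<in> E" "(y, q) \<in> E" for x r y q
    using E that unfolding good_def by blast
  have E_sm: "(sm s x, s * r) \<in> E" if "(x, r) \<in> E" "s > 0" for x r s
    using E that unfolding good_def by blast
  have E_V: "x \<in> V" if "(x, r) \<in> E" for x r using E that unfolding good_def by blast
  have E_E0: "E0 \<subseteq> E" and E_neg1: "(z, -1) \<notin> E" using E unfolding good_def by blast+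
  have E_p: "(x, r) \<in> E" if "x \<in> V" "p x \<le> r" for x r using E_E0 E0p that by blast
  have E_z: "r \<ge> 0" if "(z, r) \<in> E" for r
  proof (rule ccontr)
    assume "\<not> 0 \<le> r"
    hence "(sm (1 / -r) z, (1 / -r) * r) \<in> E" using that by (intro E_sm) auto
    with \<open>\<not> 0 \<le> r\<close> E_neg1 show False by (simp add: sm_z)
  qed
  have E_up: "(x, q) \<in> E" if "(x, r) \<in> E" "r \<le> q" for x r q
  proof -
    have "(z, q - r) \<in> E" using that z_in pz by (intro E_p) auto
    from E_add[OF that(1) this] have "(add x z, r + (q - r)) \<in> E" .
    thus ?thesis using E_V[OF that(1)] by (simp add: add_z)
  qed
  \<comment> \<open>A missed point \<open>(x, r)\<close> cannot be adjoined to the maximal cone, so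
    the cone \<open>F\<close> that it generates together with \<open>E\<close> must contain
    \<open>(z, -1)\<close>. Solving this relation for the contribution of \<open>E\<close> and
    rescaling gives \<open>(-x, -r)\<close>: \<open>E\<close> and \<open>-E\<close> together fill
    \<open>V \<times> \<real>\<close>.\<close>
  have E_total: "(sm (-1) x, -r) \<in> E" if x: "x \<in> V" and n: "(x, r) \<notin> E" for x r
  proof -
    define F where "F = {(add y (sm s x), q + s * r) | y q s. (y, q) \<in> E \<and> s \<ge> 0}"
    have EF: "E \<subseteq> F"
    proof
      fix e assume "e \<in> E"
      moreover obtain y q where e: "e = (y, q)" by (cases e)
      ultimately have "(y, q) \<in> E" "(add y (sm 0 x), q + 0 * r) = e"
        using E_V x by (auto simp: sm_zero add_z)
      thus "e \<in> F" unfolding F_def by (intro CollectI) (metis order_refl)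
    qed
    have "(add z (sm 1 x), 0 + 1 * r) \<in> F"
      unfolding F_def using E_p[of z 0] pz z_in by (intro CollectI) (metis order_refl zero_le_one)
    hence "(x, r) \<in> F" using x by (simp add: sm_one comm[of z] z_in add_z)
    hence "F \<noteq> E" using n by blast
    hence "\<not> good F" using maxE EF by blast
    moreover have "E0 \<subseteq> F" using E_E0 EF by blast
    moreover have "F \<subseteq> V \<times> UNIV" unfolding F_def using E_V x by (auto intro: add_in sm_in)
    moreover have "(add a b, q + q') \<in> F" if ab: "(a, q) \<in> F" "(b, q') \<in> F" for a b q q'
    proof -
      obtain y1 q1 s1 y2 q2 s2 where *: "a = add y1 (sm s1 x)" "q = q1 + s1 * r" "(y1, q1) \<in> E" "s1 \<ge> 0"
        "b = add y2 (sm s2 x)" "q' = q2 + s2 * r" "(y2, q2) \<in> E" "s2 \<ge> 0"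
        using ab unfolding F_def by blast
      have "add a b = add (add y1 y2) (sm (s1 + s2) x)"
        unfolding * using *(3,7) E_V x by (simp add: add_interchange sm_in sm_add_left)
      moreover have "q + q' = (q1 + q2) + (s1 + s2) * r" using * by (simp add: algebra_simps)
      moreover have "(add y1 y2, q1 + q2) \<in> E" "s1 + s2 \<ge> 0" using * E_add by auto
      ultimately show ?thesis unfolding F_def by blast
    qed
    moreover have "(sm s a, s * q) \<in> F" if ab: "(a, q) \<in> F" "s > 0" for a q s
    proof -
      obtain y1 q1 s1 where *: "a = add y1 (sm s1 x)" "q = q1 + s1 * r" "(y1, q1) \<in> E" "s1 \<ge> 0"
        using ab unfolding F_def by blast
      have "sm s a = add (sm s y1) (sm (s * s1) x)"
        unfolding * using *(3) E_V x by (simp add: sm_add_right sm_in sm_sm)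
      moreover have "s * q = s * q1 + (s * s1) * r" using * by (simp add: algebra_simps)
      moreover have "(sm s y1, s * q1) \<in> E" "s * s1 \<ge> 0" using * E_sm ab by auto
      ultimately show ?thesis unfolding F_def by blast
    qed
    ultimately have "(z, -1) \<in> F" unfolding good_def by blast
    then obtain y q s where y: "z = add y (sm s x)" "-1 = q + s * r" "(y, q) \<in> E" "s \<ge> 0"
      unfolding F_def by blast
    have yV: "y \<in> V" using y E_V by blast
    have "s \<noteq> 0"
    proof
      assume "s = 0"
      hence "y = z" "q = -1" using y x yV by (auto simp: sm_zero add_z)
      thus False using y(3) E_neg1 by metis
    qed
    hence s: "s > 0" using y by simp
    have "sm (-s) x = add y (add (sm s x) (sm (-s) x))"
      using y(1) x yV by (metis assoc comm add_z sm_in z_in)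
    also have "add (sm s x) (sm (-s) x) = z" using sm_add_left[of x s "-s"] x by (simp add: sm_zero)
    also have "add y z = y" using yV by (rule add_z)
    finally have "y = sm (-s) x" ..
    hence "(sm (1/s) (sm (-s) x), (1/s) * q) \<in> E" using y s by (intro E_sm) auto
    moreover have "(1/s) * q \<le> -r" using y(2) s by (simp add: field_simps)
    ultimately show ?thesis using x s E_up by (auto simp: sm_sm)
  qed
  define w where "w x = Inf {r. (x, r) \<in> E}" for x
  have bdd: "-p (sm (-1) x) \<le> r" if "(x, r) \<in> E" for x r
  proof -
    have x: "x \<in> V" using that E_V by blast
    have "(add x (sm (-1) x), r + p (sm (-1) x)) \<in> E" using x by (intro E_add[OF that] E_p sm_in) auto
    hence "(z, r + p (sm (-1) x)) \<in> E" using x by (simp add: add_neg)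
    thus ?thesis using E_z by fastforce
  qed
  have bb: "bdd_below {r. (x, r) \<in> E}" for x using bdd by (intro bdd_belowI) blast
  have w_le: "w x \<le> r" if "(x, r) \<in> E" for x r
    unfolding w_def using that bb by (intro cInf_lower) auto
  have w_greatest: "l \<le> w x" if "x \<in> V" "\<And>r. (x, r) \<in> E \<Longrightarrow> l \<le> r" for x l
    unfolding w_def using that E_p by (intro cInf_greatest) auto
  have w_p: "w x \<le> p x" if "x \<in> V" for x using that E_p w_le by blast
  have w_sub: "w (add x y) \<le> w x + w y" if "x \<in> V" "y \<in> V" for x y
  proof -
    have "w (add x y) - w y \<le> w x"
    proof (rule w_greatest[OF that(1)])
      fix r assume r: "(x, r) \<in> E"
      have "w (add x y) - r \<le> w y"
      proof (rule w_greatest[OF that(2)])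
        fix q assume "(y, q) \<in> E"
        thus "w (add x y) - r \<le> q" using w_le[OF E_add[OF r]] by fastforce
      qed
      thus "w (add x y) - w y \<le> r" by simp
    qed
    thus ?thesis by simp
  qed
  have w_z: "w z = 0"
  proof (rule antisym)
    show "w z \<le> 0" using w_p[OF z_in] pz by simp
    show "0 \<le> w z" using E_z z_in by (intro w_greatest) auto
  qed
  have w_neg: "w (sm (-1) x) = - w x" if "x \<in> V" for x
  proof (rule antisym)
    show "- w x \<le> w (sm (-1) x)"
      using w_sub[OF that sm_in[OF that, of "-1"]] w_z by (simp add: add_neg that)
    \<comment> \<open>Totality of the cone enters here: below \<open>w (-x)\<close> no point over
      \<open>-x\<close> lies in \<open>E\<close>, so the opposite points do. This upgrades the
      sublinear \<open>w\<close> to an additive one.\<close>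
    show "w (sm (-1) x) \<le> - w x"
    proof (rule dense_le)
      fix l assume l: "l < w (sm (-1) x)"
      hence "(sm (-1) x, l) \<notin> E" using w_le by fastforce
      hence "(sm (-1) (sm (-1) x), -l) \<in> E" using E_total that sm_in by blast
      hence "(x, -l) \<in> E" using that by (simp add: sm_sm sm_one)
      thus "l \<le> - w x" using w_le by fastforce
    qed
  qed
  have w_add: "w (add x y) = w x + w y" if "x \<in> V" "y \<in> V" for x y
  proof (rule antisym[OF w_sub[OF that]])
    have "w (add (sm (-1) x) (sm (-1) y)) \<le> - w x - w y"
      using w_sub[of "sm (-1) x" "sm (-1) y"] that by (simp add: sm_in w_neg)
    hence "w (sm (-1) (add x y)) \<le> - w x - w y" using that by (simp add: sm_add_right)
    thus "w x + w y \<le> w (add x y)" using that by (simp add: w_neg add_in)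
  qed
  have w_pos: "w (sm s x) = s * w x" if "x \<in> V" "s > 0" for s x
  proof -
    have *: "t * w y \<ge> w (sm t y)" if "y \<in> V" "t > 0" for t y
    proof -
      have "w (sm t y) / t \<le> w y"
      proof (rule w_greatest[OF that(1)])
        fix r assume "(y, r) \<in> E"
        thus "w (sm t y) / t \<le> r" using w_le[OF E_sm, of y r t] that by (simp add: field_simps)
      qed
      thus ?thesis using that by (simp add: field_simps)
    qed
    have "w x \<le> (1 / s) * w (sm s x)"
      using *[of "sm s x" "1 / s"] that by (simp add: sm_in sm_sm sm_one)
    hence "s * w x \<le> w (sm s x)" using that by (simp add: field_simps)
    thus ?thesis using *[OF that] by simp
  qed
  have w_sm: "w (sm r x) = r * w x" if "x \<in> V" for r x
  proof -
    consider "r > 0" | "r = 0" | "r < 0" by linarith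
    thus ?thesis
    proof cases
      case 3
      have "w (sm r x) = w (sm (-1) (sm (-r) x))" using that by (simp add: sm_sm)
      thus ?thesis using 3 that w_pos[of x "-r"] by (simp add: w_neg sm_in)
    qed (use that w_pos w_z in \<open>auto simp: sm_zero\<close>)
  qed
  have w_C: "\<beta> \<le> w c" if "c \<in> C" for c
  proof -
    have c: "c \<in> V" using that C by blast
    have "p (add (sm (-1) c) (sm 1 c)) - 1 * \<beta> \<le> -\<beta>"
      using c pz comm[of "sm (-1) c" c] by (simp add: sm_one add_neg sm_in)
    hence "(sm (-1) c, -\<beta>) \<in> E0"
      using that c by (intro E0I[of _ 1 c]) (auto intro: sm_in)
    hence "w (sm (-1) c) \<le> -\<beta>" using E_E0 w_le by blast
    thus ?thesis using c by (simp add: w_neg)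
  qed
  show ?thesis by (intro exI[of _ w] conjI ballI allI w_add w_sm w_p w_C)
qed

end

section \<open>Scalar fields with conjugation\<close>

text \<open>Real and complex scalars share one development through these axioms.
  \<open>riesz\<close> represents every real-linear functional on the field as
  \<open>re (a * z)\<close>, which is what lifts real Hahn-Banach functionals to linear ones over
  the field. The class \<open>heine_borel\<close> supplies compact balls and completeness.\<close>

locale conj_field =
  fixes cj :: "'k::{real_normed_field, heine_borel} \<Rightarrow> 'k" and re :: "'k \<Rightarrow> real"
  assumes cj_add: "cj (x + y) = cj x + cj y"
    and cj_mult: "cj (x * y) = cj x * cj y"
    and cj_cj [simp]: "cj (cj x) = x"
    and cj_mult_self: "cj x * x = of_real ((norm x)\<^sup>2)"
    and add_cj: "x + cj x = of_real (2 * re x)"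
    and riesz: "\<lbrakk>\<And>a b. q (a + b) = q a + q b; \<And>r a. q (of_real r * a) = r * q a\<rbrakk>
      \<Longrightarrow> \<exists>z. \<forall>a. q a = re (a * z)"
begin

lemma cj_0 [simp]: "cj 0 = 0"
  using cj_add[of 0 0] by simp

lemma cj_1 [simp]: "cj 1 = 1"
  using cj_mult_self[of 1] by simp

lemma cj_sum: "cj (sum f A) = (\<Sum>a\<in>A. cj (f a))"
  by (induction A rule: infinite_finite_induct) (auto simp: cj_add)

lemma cj_of_real [simp]: "cj (of_real r) = of_real r"
proof (cases "r = 0")
  case False
  have "cj (of_real r) * of_real r = of_real r * (of_real r :: 'k)"
    using cj_mult_self[of "of_real r"] by (simp add: power2_eq_square flip: of_real_mult)
  thus ?thesis using False by simp
qed simp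

lemma cj_divide_of_real: "cj (x / of_real s) = cj x / of_real s"
proof -
  have "x / of_real s = x * of_real (1 / s)" for x :: 'k by (simp add: divide_inverse)
  thus ?thesis by (simp only: cj_mult cj_of_real)
qed

lemma norm_cj [simp]: "norm (cj x) = norm x"
proof (cases "x = 0")
  case False
  have "norm (cj x * x) = norm (of_real ((norm x)\<^sup>2) :: 'k)" using cj_mult_self[of x] by simp
  hence "norm (cj x) * norm x = norm x * norm x" by (simp add: norm_mult power2_eq_square)
  thus ?thesis using False by simp
qed simp

lemma re_add: "re (x + y) = re x + re y"
proof -
  have "of_real (2 * re (x + y)) = (of_real (2 * re x) + of_real (2 * re y) :: 'k)"
    unfolding add_cj[symmetric] cj_add by simp
  thus ?thesis unfolding of_real_add[symmetric] of_real_eq_iff by simp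
qed

lemma re_scale: "re (of_real r * x) = r * re x"
proof -
  have "of_real (2 * re (of_real r * x)) = (of_real r * of_real (2 * re x) :: 'k)"
    unfolding add_cj[symmetric] cj_mult by (simp add: algebra_simps)
  thus ?thesis unfolding of_real_mult[symmetric] of_real_eq_iff by simp
qed

lemma re_of_real [simp]: "re (of_real r) = r"
proof -
  have "of_real (2 * re (of_real r)) = (of_real (2 * r) :: 'k)"
    unfolding add_cj[symmetric] by simp
  thus ?thesis unfolding of_real_eq_iff by simp
qed

lemma re_0 [simp]: "re 0 = 0"
  using re_of_real[of 0] by simp

lemma re_minus: "re (- x) = - re x"
  using re_scale[of "-1" x] by simp

lemma re_diff: "re (x - y) = re x - re y"
  using re_add[of x "-y"] by (simp add: re_minus)

lemma re_sum: "re (sum f A) = (\<Sum>a\<in>A. re (f a))"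
  by (induction A rule: infinite_finite_induct) (auto simp: re_add)

lemma re_le_norm: "re x \<le> norm x"
proof -
  have "\<bar>2 * re x\<bar> = norm (x + cj x)" unfolding add_cj by (simp only: norm_of_real)
  also have "\<dots> \<le> 2 * norm x" using norm_triangle_ineq[of x "cj x"] by simp
  finally show ?thesis by simp
qed

lemma abs_re_le_norm: "\<bar>re x\<bar> \<le> norm x"
  using re_le_norm[of x] re_le_norm[of "-x"] by (simp add: re_minus)

lemma continuous_on_cj [continuous_intros]:
  assumes "continuous_on S f" shows "continuous_on S (\<lambda>x. cj (f x))"
proof -
  have "bounded_linear cj"
  proof (rule bounded_linear_intro)
    show "cj (r *\<^sub>R x) = r *\<^sub>R cj x" for r x by (simp add: scaleR_conv_of_real cj_mult)
    show "norm (cj x) \<le> norm x * 1" for x by simp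
  qed (rule cj_add)
  thus ?thesis using assms by (rule bounded_linear.continuous_on)
qed

lemma continuous_on_re [continuous_intros]:
  assumes "continuous_on S f" shows "continuous_on S (\<lambda>x. re (f x))"
proof -
  have "bounded_linear re"
  proof (rule bounded_linear_intro)
    show "re (r *\<^sub>R x) = r *\<^sub>R re x" for r x by (simp add: scaleR_conv_of_real re_scale)
    show "norm (re x) \<le> norm x * 1" for x using abs_re_le_norm by simp
  qed (rule re_add)
  thus ?thesis using assms by (rule bounded_linear.continuous_on)
qed

lemma phase:
  fixes x :: 'k
  shows "\<exists>u. norm u = 1 \<and> u * x = of_real (norm x)"
proof (cases "x = 0")
  case True thus ?thesis by (intro exI[of _ 1]) simp
next
  case False
  show ?thesis
  proof (intro exI conjI)
    show "norm (cj x / of_real (norm x)) = 1" using False by (simp add: norm_divide)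
    show "cj x / of_real (norm x) * x = of_real (norm x)"
      using False by (simp add: cj_mult_self power2_eq_square)
  qed
qed

end

lemma conj_field_real: "conj_field (id :: real \<Rightarrow> real) id"
proof
  fix q :: "real \<Rightarrow> real"
  assume q: "\<And>r a. q (of_real r * a) = r * q a"
  have "q a = id (a * q 1)" for a using q[of a 1] by simp
  thus "\<exists>z. \<forall>a. q a = id (a * z)" by blast
qed (auto simp: power2_eq_square)

lemma conj_field_complex: "conj_field cnj Re"
proof
  fix q :: "complex \<Rightarrow> real"
  assume a: "\<And>a b. q (a + b) = q a + q b" and s: "\<And>r a. q (of_real r * a) = r * q a"
  have "q x = Re (x * Complex (q 1) (- q \<i>))" for x
  proof -
    have "x = of_real (Re x) * 1 + of_real (Im x) * \<i>" by (simp add: complex_eq_iff)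
    hence "q x = Re x * q 1 + Im x * q \<i>" using a s by metis
    thus ?thesis by simp
  qed
  thus "\<exists>z. \<forall>a. q a = Re (a * z)" by blast
next
  show "cnj x * x = of_real ((norm x)\<^sup>2)" for x
    by (metis complex_norm_square mult.commute)
qed (auto simp: complex_add_cnj)

section \<open>Norming functionals\<close>

locale conj_banach = conj_field cj re
  for cj :: "'k::{real_normed_field, heine_borel} \<Rightarrow> 'k" and re :: "'k \<Rightarrow> real" +
  fixes X :: "('v, 'k) nspace"
  assumes banach: "is_banach X"
begin

lemmas banach_axioms = banach[unfolded is_banach_def Let_def]

lemmas zero_in = banach_axioms[THEN conjunct1]
lemmas add_in = banach_axioms[THEN conjunct2, THEN conjunct1, rule_format]
lemmas smult_in = banach_axioms[THEN conjunct2, THEN conjunct2, THEN conjunct1, rule_format]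
lemmas add_assoc = banach_axioms[THEN conjunct2, THEN conjunct2, THEN conjunct2, THEN conjunct1, rule_format]
lemmas add_comm = banach_axioms[THEN conjunct2, THEN conjunct2, THEN conjunct2, THEN conjunct2, THEN conjunct1, rule_format]
lemmas add_zero = banach_axioms[THEN conjunct2, THEN conjunct2, THEN conjunct2, THEN conjunct2, THEN conjunct2, THEN conjunct1, rule_format]
lemmas add_neg = banach_axioms[THEN conjunct2, THEN conjunct2, THEN conjunct2, THEN conjunct2, THEN conjunct2, THEN conjunct2, THEN conjunct1, rule_format]
lemmas smult_one = banach_axioms[THEN conjunct2, THEN conjunct2, THEN conjunct2, THEN conjunct2, THEN conjunct2, THEN conjunct2, THEN conjunct2, THEN conjunct1, rule_format]
lemmas smult_smult = banach_axioms[THEN conjunct2, THEN conjunct2, THEN conjunct2, THEN conjunct2, THEN conjunct2, THEN conjunct2, THEN conjunct2, THEN conjunct2, THEN conjunct1, rule_format]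
lemmas smult_add_left = banach_axioms[THEN conjunct2, THEN conjunct2, THEN conjunct2, THEN conjunct2, THEN conjunct2, THEN conjunct2, THEN conjunct2, THEN conjunct2, THEN conjunct2, THEN conjunct1, rule_format]
lemmas smult_add_right = banach_axioms[THEN conjunct2, THEN conjunct2, THEN conjunct2, THEN conjunct2, THEN conjunct2, THEN conjunct2, THEN conjunct2, THEN conjunct2, THEN conjunct2, THEN conjunct2, THEN conjunct1, rule_format]
lemmas nn_nonneg = banach_axioms[THEN conjunct2, THEN conjunct2, THEN conjunct2, THEN conjunct2, THEN conjunct2, THEN conjunct2, THEN conjunct2, THEN conjunct2, THEN conjunct2, THEN conjunct2, THEN conjunct2, THEN conjunct1, rule_format]
lemmas nn_eq_0 = banach_axioms[THEN conjunct2, THEN conjunct2, THEN conjunct2, THEN conjunct2, THEN conjunct2, THEN conjunct2, THEN conjunct2, THEN conjunct2, THEN conjunct2, THEN conjunct2, THEN conjunct2, THEN conjunct2, THEN conjunct1, rule_format]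
lemmas nn_smult = banach_axioms[THEN conjunct2, THEN conjunct2, THEN conjunct2, THEN conjunct2, THEN conjunct2, THEN conjunct2, THEN conjunct2, THEN conjunct2, THEN conjunct2, THEN conjunct2, THEN conjunct2, THEN conjunct2, THEN conjunct2, THEN conjunct1, rule_format]
lemmas nn_add = banach_axioms[THEN conjunct2, THEN conjunct2, THEN conjunct2, THEN conjunct2, THEN conjunct2, THEN conjunct2, THEN conjunct2, THEN conjunct2, THEN conjunct2, THEN conjunct2, THEN conjunct2, THEN conjunct2, THEN conjunct2, THEN conjunct2, THEN conjunct1, rule_format]

lemma smult_0: "x \<in> ns_carrier X \<Longrightarrow> ns_smult X 0 x = ns_zero X"
  using smult_add_left[of x 1 "-1"] by (simp add: smult_one add_neg)

lemma smult_zero: "ns_smult X a (ns_zero X) = ns_zero X"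
  using smult_smult[OF zero_in, of a 0] smult_0[OF zero_in] by simp

text \<open>Restriction of scalars to the reals, so that \<open>mazur_orlicz\<close> applies to
  complex spaces as well.\<close>

sublocale real_carrier_space "ns_carrier X" "ns_add X" "ns_zero X" "\<lambda>r. ns_smult X (of_real r)"
  by unfold_locales
    (auto simp: zero_in add_in smult_in add_assoc add_zero smult_one smult_0 smult_smult
      smult_add_left smult_add_right intro: add_comm)

definition klinear :: "('v \<Rightarrow> 'k) \<Rightarrow> bool" where
  "klinear f \<longleftrightarrow> (\<forall>x\<in>ns_carrier X. \<forall>y\<in>ns_carrier X. f (ns_add X x y) = f x + f y) \<and>
     (\<forall>a. \<forall>x\<in>ns_carrier X. f (ns_smult X a x) = a * f x)"

text \<open>A real-linear functional \<open>w\<close> is the real part of a unique \<open>\<bbbK>\<close>-linear one, whose value at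
  \<open>x\<close> represents \<open>a \<mapsto> w (a x)\<close> on the scalar field.\<close>

lemma norming_functional:
  assumes x0: "x0 \<in> ns_carrier X"
  obtains f where "klinear f" "\<And>x. x \<in> ns_carrier X \<Longrightarrow> norm (f x) \<le> ns_norm X x"
    "ns_norm X x0 \<le> norm (f x0)"
proof -
  have "\<exists>w. (\<forall>x\<in>ns_carrier X. \<forall>y\<in>ns_carrier X. w (ns_add X x y) = w x + w y) \<and>
    (\<forall>r. \<forall>x\<in>ns_carrier X. w (ns_smult X (of_real r) x) = r * w x) \<and>
    (\<forall>x\<in>ns_carrier X. w x \<le> ns_norm X x) \<and> (\<forall>c\<in>{x0}. ns_norm X x0 \<le> w c)"
  proof (rule mazur_orlicz[of "ns_norm X" "{x0}" "ns_norm X x0"])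
    fix c d and s t :: real
    assume *: "c \<in> {x0}" "d \<in> {x0}" "s + t = 1"
    thus "ns_add X (ns_smult X (of_real s) c) (ns_smult X (of_real t) d) \<in> {x0}"
      using sm_add_left[OF x0, of s t] by (simp add: smult_one x0)
  qed (use x0 in \<open>auto simp: nn_add nn_smult\<close>)
  then obtain w where w: "\<forall>x\<in>ns_carrier X. \<forall>y\<in>ns_carrier X. w (ns_add X x y) = w x + w y"
    "\<forall>r. \<forall>x\<in>ns_carrier X. w (ns_smult X (of_real r) x) = r * w x"
    "\<forall>x\<in>ns_carrier X. w x \<le> ns_norm X x" "\<forall>c\<in>{x0}. ns_norm X x0 \<le> w c"
    by (elim exE conjE) (rule that)
  note w_add = w(1)[rule_format] and w_sm = w(2)[rule_format] and w_le = w(3)[rule_format]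
    and w_x0 = w(4)[rule_format, OF singletonI]
  have "\<exists>z. \<forall>a. w (ns_smult X a x) = re (a * z)" if "x \<in> ns_carrier X" for x
    using that by (intro riesz) (auto simp: smult_add_left w_add smult_in w_sm simp flip: smult_smult)
  then obtain f where f: "\<And>x a. x \<in> ns_carrier X \<Longrightarrow> w (ns_smult X a x) = re (a * f x)"
    by metis
  have uniq: "z = f x" if x: "x \<in> ns_carrier X" and z: "\<And>a. w (ns_smult X a x) = re (a * z)" for x z
  proof -
    \<comment> \<open>The test scalar \<open>a = cj (z - f x)\<close> turns equality of the two
      functionals into \<open>|z - f x|^2 = 0\<close>.\<close>
    have "re (cj (z - f x) * (z - f x)) = 0"
      using z f[OF x] by (simp add: right_diff_distrib re_diff)
    hence "(norm (z - f x))\<^sup>2 = 0" by (simp only: cj_mult_self re_of_real)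
    thus ?thesis by simp
  qed
  have "f (ns_add X x y) = f x + f y" if "x \<in> ns_carrier X" "y \<in> ns_carrier X" for x y
    using that by (intro uniq[symmetric])
      (auto simp: add_in smult_add_right w_add smult_in f re_add distrib_left)
  moreover have "f (ns_smult X a x) = a * f x" if "x \<in> ns_carrier X" for a x
    using that by (intro uniq[symmetric]) (auto simp: smult_in smult_smult f mult.assoc)
  ultimately have "klinear f" unfolding klinear_def by blast
  moreover have "norm (f x) \<le> ns_norm X x" if x: "x \<in> ns_carrier X" for x
  proof -
    \<comment> \<open>Rotating \<open>x\<close> by a phase makes the value of \<open>f\<close> real
      and nonnegative, so the bound on the real part \<open>w\<close> bounds the modulus of
      \<open>f\<close>.\<close>
    obtain u where u: "norm u = 1" "u * f x = of_real (norm (f x))" using phase by blast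
    have "norm (f x) = w (ns_smult X u x)" using f[OF x, of u] u by simp
    also have "\<dots> \<le> ns_norm X x" using w_le[OF smult_in[OF x, of u]] u x by (simp add: nn_smult)
    finally show ?thesis .
  qed
  moreover have "ns_norm X x0 \<le> norm (f x0)"
  proof -
    have "ns_norm X x0 \<le> w x0" by (rule w_x0)
    also have "\<dots> = re (f x0)" using f[OF x0, of 1] x0 by (simp add: smult_one)
    also have "\<dots> \<le> norm (f x0)" by (rule re_le_norm)
    finally show ?thesis .
  qed
  ultimately show thesis using that by blast
qed

end

section \<open>Weighted projections and the minimax argument\<close>

context conj_field
begin

definition orthonormal_rows :: "nat \<Rightarrow> nat \<Rightarrow> (nat \<Rightarrow> nat \<Rightarrow> 'k) \<Rightarrow> bool" where
  "orthonormal_rows m N U \<longleftrightarrow> (\<forall>a<m. \<forall>b<m. (\<Sum>j<N. U a j * cj (U b j)) = (if a = b then 1 else 0))"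

definition gram_mean :: "nat \<Rightarrow> nat \<Rightarrow> (nat \<Rightarrow> nat \<Rightarrow> 'k) \<Rightarrow> real" where
  "gram_mean m N U = (1 / real N) * (\<Sum>i<N. \<Sum>j<N. norm (\<Sum>k<m. cj (U k i) * U k j))"

lemma mu_rel_alt: "mu_rel cj m N = Sup (gram_mean m N ` {U. orthonormal_rows m N U})"
  unfolding mu_rel_def gram_mean_def orthonormal_rows_def by (rule arg_cong[of _ _ Sup]) blast

lemma orthonormal_rows_norm:
  assumes "orthonormal_rows m N U" "k < m"
  shows "(\<Sum>j<N. (norm (U k j))\<^sup>2) = 1"
proof -
  have "of_real (\<Sum>j<N. (norm (U k j))\<^sup>2) = (\<Sum>j<N. U k j * cj (U k j))"
    by (simp only: of_real_sum cj_mult_self[symmetric] mult.commute)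
  also have "\<dots> = of_real 1" using assms by (simp add: orthonormal_rows_def)
  finally show ?thesis by (simp only: of_real_eq_iff)
qed

text \<open>Triangle inequality, then Cauchy-Schwarz on each row of \<open>U\<close>, whose squares
  sum to 1. The crude bound \<open>m\<close> ensures that the suprema defining \<open>mu_rel\<close>
  and \<open>mu_abs\<close> are taken over bounded sets.\<close>

lemma gram_mean_le:
  assumes "orthonormal_rows m N U"
  shows "gram_mean m N U \<le> real m"
proof (cases "N = 0")
  case True thus ?thesis by (simp add: gram_mean_def)
next
  case False
  have "(\<Sum>i<N. \<Sum>j<N. norm (\<Sum>k<m. cj (U k i) * U k j))
      \<le> (\<Sum>i<N. \<Sum>j<N. \<Sum>k<m. norm (U k i) * norm (U k j))"
    by (intro sum_mono order_trans[OF norm_sum]) (simp add: norm_mult)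
  also have "\<dots> = (\<Sum>i<N. \<Sum>k<m. \<Sum>j<N. norm (U k i) * norm (U k j))"
    by (intro sum.cong refl sum.swap)
  also have "\<dots> = (\<Sum>k<m. \<Sum>i<N. \<Sum>j<N. norm (U k i) * norm (U k j))"
    by (rule sum.swap)
  also have "\<dots> = (\<Sum>k<m. (\<Sum>i<N. norm (U k i))\<^sup>2)"
    by (simp add: power2_eq_square sum_product)
  also have "\<dots> \<le> (\<Sum>k<m. (\<Sum>i<N. (norm (U k i))\<^sup>2) * real (card {..<N}))"
    by (intro sum_mono sum_squared_le_sum_of_squares)
  also have "\<dots> = real N * real m" using assms by (simp add: orthonormal_rows_norm)
  finally show ?thesis using False by (simp add: gram_mean_def field_simps)
qed

lemma orthonormal_rows_exists: "m \<le> N \<Longrightarrow> orthonormal_rows m N (\<lambda>k j. if k = j then 1 else 0)"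
  by (auto simp: orthonormal_rows_def if_distrib[of cj] if_distrib[of "(*) _"] cong: if_cong)

lemma gram_mean_le_mu_rel: "orthonormal_rows m N U \<Longrightarrow> gram_mean m N U \<le> mu_rel cj m N"
  unfolding mu_rel_alt using gram_mean_le by (intro cSup_upper bdd_aboveI2) auto

lemma mu_rel_le: "m \<le> N \<Longrightarrow> mu_rel cj m N \<le> real m"
  unfolding mu_rel_alt using gram_mean_le orthonormal_rows_exists[of m N] by (intro cSup_least) blast+

lemma gram_mean_le_mu_abs:
  assumes "orthonormal_rows m N U" "m \<le> N"
  shows "gram_mean m N U \<le> mu_abs cj m"
proof -
  have "mu_rel cj m N \<le> mu_abs cj m"
    unfolding mu_abs_def using assms mu_rel_le by (intro cSup_upper bdd_aboveI[of _ "real m"]) auto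
  thus ?thesis using gram_mean_le_mu_rel[OF assms(1)] by simp
qed

lemma mu_abs_nonneg: "0 \<le> mu_abs cj m"
proof -
  have "0 \<le> gram_mean m m (\<lambda>k j. if k = j then 1 else 0)"
    unfolding gram_mean_def by (intro mult_nonneg_nonneg sum_nonneg) auto
  also have "\<dots> \<le> mu_abs cj m" by (intro gram_mean_le_mu_abs orthonormal_rows_exists) auto
  finally show ?thesis .
qed

lemma less_mu_abs:
  assumes "c < mu_abs cj m"
  obtains N U where "m \<le> N" "orthonormal_rows m N U" "c < gram_mean m N U"
proof -
  have "\<exists>x\<in>{mu_rel cj m N |N. m \<le> N}. c < x"
    using assms unfolding mu_abs_def by (intro less_cSupD) auto
  then obtain N where N: "m \<le> N" "c < mu_rel cj m N" by blast
  have "\<exists>x\<in>gram_mean m N ` {U. orthonormal_rows m N U}. c < x"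
    using N orthonormal_rows_exists[OF N(1)] unfolding mu_rel_alt by (intro less_cSupD) auto
  thus thesis using that N(1) by blast
qed

section \<open>Orthonormalisation with respect to a weighted inner product\<close>

definition full_column_rank :: "nat \<Rightarrow> nat \<Rightarrow> (nat \<Rightarrow> nat \<Rightarrow> 'k) \<Rightarrow> bool" where
  "full_column_rank N m M \<longleftrightarrow> (\<forall>a. (\<forall>j<N. (\<Sum>k<m. M j k * a k) = 0) \<longrightarrow> (\<forall>k<m. a k = 0))"

lemma full_column_rankD:
  "\<lbrakk>full_column_rank N m M; \<And>j. j < N \<Longrightarrow> (\<Sum>k<m. M j k * a k) = 0; k < m\<rbrakk> \<Longrightarrow> a k = 0"
  by (simp add: full_column_rank_def)

text \<open>Induction over the columns: subtract the weighted projection of the new column and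
  normalise. Positive weights make the form definite. \<open>R\<close> and \<open>R'\<close> are the
  base changes in both directions, so the columns of \<open>V\<close> and of \<open>M\<close> span
  the same space.\<close>

lemma gram_schmidt:
  fixes n :: "nat \<Rightarrow> real" and M :: "nat \<Rightarrow> nat \<Rightarrow> 'k"
  assumes n: "\<forall>j<N. n j > 0"
    and indep: "full_column_rank N m M"
  shows "\<exists>V R R'. (\<forall>k<m. \<forall>l<m. (\<Sum>j<N. of_real (n j) * (cj (V j k) * V j l)) = (if k = l then 1 else 0)) \<and>
     (\<forall>k<m. \<forall>j<N. V j k = (\<Sum>l<m. M j l * R k l)) \<and>
     (\<forall>k<m. \<forall>j<N. M j k = (\<Sum>l<m. V j l * R' k l))"
  using indep
proof (induction m)
  case 0
  show ?case by simp
next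
  case (Suc m)
  have "full_column_rank N m M"
    unfolding full_column_rank_def
  proof (intro allI impI)
    fix a k assume a: "\<forall>j<N. (\<Sum>k<m. M j k * a k) = 0" and k: "k < m"
    have "(if k = m then 0 else a k) = 0"
    proof (rule full_column_rankD[OF Suc.prems, where a = "\<lambda>k. if k = m then 0 else a k"])
      show "(\<Sum>k<Suc m. M j k * (if k = m then 0 else a k)) = 0" if "j < N" for j
        using a that by simp
    qed (use k in simp)
    thus "a k = 0" using k by simp
  qed
  from Suc.IH[OF this] obtain V R R' where
    on': "\<forall>k<m. \<forall>l<m. (\<Sum>j<N. of_real (n j) * (cj (V j k) * V j l)) = (if k = l then 1 else 0)"
    and VM: "\<forall>k<m. \<forall>j<N. V j k = (\<Sum>l<m. M j l * R k l)"
    and MV: "\<forall>k<m. \<forall>j<N. M j k = (\<Sum>l<m. V j l * R' k l)"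
      by (elim exE conjE) (rule that)
  have on: "(\<Sum>j<N. of_real (n j) * (cj (V j k) * V j l)) = (if k = l then 1 else 0)" if "k < m" "l < m" for k l
    using on' that by blast
  have R: "V j k = (\<Sum>l<m. M j l * R k l)" if "k < m" "j < N" for k j using VM that by blast
  have R': "M j k = (\<Sum>l<m. V j l * R' k l)" if "k < m" "j < N" for k j using MV that by blast
  define h where "h l = (\<Sum>j<N. of_real (n j) * (cj (V j l) * M j m))" for l
  define u where "u j = M j m - (\<Sum>l<m. V j l * h l)" for j
  define s where "s = sqrt (\<Sum>j<N. n j * (norm (u j))\<^sup>2)"
  \<comment> \<open>\<open>r\<close> expresses the projection of the new column in the original
    columns. A vanishing remainder \<open>u\<close> would then be a linear relation with coefficient
    1 at column \<open>m\<close>, against full rank.\<close>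
  define r where "r k = (\<Sum>l<m. R l k * h l)" for k
  have Vh: "(\<Sum>l<m. V j l * h l) = (\<Sum>k<m. M j k * r k)" if "j < N" for j
  proof -
    have "(\<Sum>l<m. V j l * h l) = (\<Sum>l<m. \<Sum>k<m. M j k * (R l k * h l))"
      using that by (simp add: R sum_distrib_right mult.assoc)
    also have "\<dots> = (\<Sum>k<m. \<Sum>l<m. M j k * (R l k * h l))" by (rule sum.swap)
    finally show ?thesis by (simp add: r_def sum_distrib_left)
  qed
  have s2: "s\<^sup>2 = (\<Sum>j<N. n j * (norm (u j))\<^sup>2)"
    unfolding s_def using n by (intro real_sqrt_pow2 sum_nonneg) (simp add: less_imp_le)
  have "s \<noteq> 0"
  proof
    assume "s = 0"
    hence "(\<Sum>j<N. n j * (norm (u j))\<^sup>2) = 0" using s2 by simp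
    hence "\<forall>j\<in>{..<N}. n j * (norm (u j))\<^sup>2 = 0"
      using n by (subst (asm) sum_nonneg_eq_0_iff) (auto simp: less_imp_le)
    hence "n j * (norm (u j))\<^sup>2 = 0" if "j < N" for j using that by blast
    hence u0: "u j = 0" if "j < N" for j using n that by force
    have "(if m = m then 1 else - r m) = 0"
    proof (rule full_column_rankD[OF Suc.prems, where a = "\<lambda>k. if k = m then 1 else - r k"])
      fix j assume j: "j < N"
      have "(\<Sum>k<Suc m. M j k * (if k = m then 1 else - r k)) = M j m - (\<Sum>k<m. M j k * r k)"
        by (simp add: sum_negf)
      also have "\<dots> = u j" using Vh[OF j] by (simp add: u_def)
      finally show "(\<Sum>k<Suc m. M j k * (if k = m then 1 else - r k)) = 0" using u0[OF j] by simp
    qed simp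
    thus False by simp
  qed
  hence s: "of_real s \<noteq> (0 :: 'k)" by simp
  have orth: "(\<Sum>j<N. of_real (n j) * (cj (V j k) * u j)) = 0" if k: "k < m" for k
  proof -
    have "(\<Sum>j<N. of_real (n j) * (cj (V j k) * u j))
        = h k - (\<Sum>j<N. \<Sum>l<m. of_real (n j) * (cj (V j k) * V j l) * h l)"
      by (simp add: u_def h_def algebra_simps sum_subtractf sum_distrib_left)
    also have "(\<Sum>j<N. \<Sum>l<m. of_real (n j) * (cj (V j k) * V j l) * h l)
        = (\<Sum>l<m. (\<Sum>j<N. of_real (n j) * (cj (V j k) * V j l)) * h l)"
      by (subst sum.swap) (simp add: sum_distrib_right)
    also have "\<dots> = (\<Sum>l<m. if k = l then h l else 0)"
      using k by (intro sum.cong) (auto simp: on)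
    also have "\<dots> = h k" using k by simp
    finally show ?thesis by simp
  qed
  have orth': "(\<Sum>j<N. of_real (n j) * (cj (u j) * V j k)) = 0" if k: "k < m" for k
  proof -
    have "(\<Sum>j<N. of_real (n j) * (cj (u j) * V j k)) = cj (\<Sum>j<N. of_real (n j) * (cj (V j k) * u j))"
      by (simp add: cj_sum cj_mult mult.commute mult.left_commute)
    thus ?thesis using orth[OF k] by simp
  qed
  have unit: "(\<Sum>j<N. of_real (n j) * (cj (u j) * u j)) = of_real (s\<^sup>2)"
    unfolding s2 by (simp add: cj_mult_self)
  define W where "W j k = (if k = m then u j / of_real s else V j k)" for j k
  have W_on: "(\<Sum>j<N. of_real (n j) * (cj (W j k) * W j l)) = (if k = l then 1 else 0)"
    if kl: "k < Suc m" "l < Suc m" for k l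
  proof -
    consider "k < m" "l < m" | "k < m" "l = m" | "k = m" "l < m" | "k = m" "l = m"
      using kl by linarith
    thus ?thesis
    proof cases
      case 1 thus ?thesis by (simp add: W_def on)
    next
      case 2
      have "(\<Sum>j<N. of_real (n j) * (cj (W j k) * W j l))
          = (\<Sum>j<N. of_real (n j) * (cj (V j k) * u j)) / of_real s"
        using 2 by (simp add: W_def sum_divide_distrib)
      thus ?thesis using 2 orth by simp
    next
      case 3
      have "(\<Sum>j<N. of_real (n j) * (cj (W j k) * W j l))
          = (\<Sum>j<N. of_real (n j) * (cj (u j) * V j l)) / of_real s"
        using 3 by (simp add: W_def sum_divide_distrib cj_divide_of_real)
      thus ?thesis using 3 orth' by simp
    next
      case 4
      have "(\<Sum>j<N. of_real (n j) * (cj (W j k) * W j l))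
          = (\<Sum>j<N. of_real (n j) * (cj (u j) * u j)) / of_real (s\<^sup>2)"
        using 4 by (simp add: W_def sum_divide_distrib cj_divide_of_real power2_eq_square)
      thus ?thesis using 4 s unfolding unit by simp
    qed
  qed
  define Q where "Q k l = (if k = m then (if l = m then 1 else - r l) / of_real s
    else if l = m then 0 else R k l)" for k l
  define Q' where "Q' k l = (if k = m then if l = m then of_real s else h l
    else if l = m then 0 else R' k l)" for k l
  have W_M: "W j k = (\<Sum>l<Suc m. M j l * Q k l)" if k: "k < Suc m" and j: "j < N" for k j
  proof (cases "k = m")
    case True
    have "(\<Sum>l<Suc m. M j l * Q k l) = (M j m - (\<Sum>l<m. M j l * r l)) / of_real s"
      using True by (simp add: Q_def sum_negf sum_divide_distrib diff_divide_distrib)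
    thus ?thesis using Vh[OF j] True by (simp add: W_def u_def)
  next
    case False
    hence "k < m" using k by simp
    thus ?thesis using R j by (simp add: W_def Q_def)
  qed
  have M_W: "M j k = (\<Sum>l<Suc m. W j l * Q' k l)" if k: "k < Suc m" and j: "j < N" for k j
  proof (cases "k = m")
    case True
    thus ?thesis using s by (simp add: W_def Q'_def u_def)
  next
    case False
    hence "k < m" using k by simp
    thus ?thesis using R'[OF _ j, of k] by (simp add: W_def Q'_def)
  qed
  show ?case
    by (intro exI[of _ W] exI[of _ Q] exI[of _ Q'] conjI allI impI W_on W_M M_W)
qed

end

text \<open>Positions in a concatenation of \<open>N\<close> blocks of lengths
  \<open>n 0, n 1, ...\<close> are sent to the number of their block; positions past the end fall
  into the last one. Composition with this map repeats coordinate \<open>j\<close> exactly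
  \<open>n j\<close> times.\<close>

primrec block_index :: "(nat \<Rightarrow> nat) \<Rightarrow> nat \<Rightarrow> nat \<Rightarrow> nat" where
  "block_index n 0 r = 0"
| "block_index n (Suc N) r = (if r < (\<Sum>j<N. n j) then block_index n N r else N)"

lemma sum_block_index:
  fixes h :: "nat \<Rightarrow> 'a::comm_semiring_1"
  shows "(\<Sum>r<(\<Sum>j<N. n j). h (block_index n N r)) = (\<Sum>j<N. of_nat (n j) * h j)"
proof (induction N)
  case (Suc N)
  define S where "S = (\<Sum>j<N. n j)"
  have "(\<Sum>r<S + n N. h (block_index n (Suc N) r))
      = (\<Sum>r\<in>{0..<S}. h (block_index n (Suc N) r)) + (\<Sum>r\<in>{S..<S + n N}. h (block_index n (Suc N) r))"
    by (simp add: lessThan_atLeast0 sum.atLeastLessThan_concat)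
  also have "(\<Sum>r\<in>{0..<S}. h (block_index n (Suc N) r)) = (\<Sum>r<S. h (block_index n N r))"
    by (simp add: lessThan_atLeast0 S_def)
  also have "(\<Sum>r\<in>{S..<S + n N}. h (block_index n (Suc N) r)) = (\<Sum>r\<in>{S..<S + n N}. h N)"
    by (intro sum.cong) (auto simp: S_def)
  finally show ?case using Suc.IH by (simp add: S_def)
qed simp

section \<open>Projection matrices with small weighted mean row sum\<close>

context conj_field
begin

text \<open>For \<open>M\<close> of full column rank the matrices \<open>M c\<close> with such
  \<open>c\<close> are exactly the projections onto the column space of \<open>M\<close>. The
  condition is affine in \<open>c\<close>, so the candidates form a convex set, as the separation
  argument requires.\<close>

definition left_inverse :: "nat \<Rightarrow> nat \<Rightarrow> (nat \<Rightarrow> nat \<Rightarrow> 'k) \<Rightarrow> (nat \<Rightarrow> nat \<Rightarrow> 'k) \<Rightarrow> bool" where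
  "left_inverse m N c M \<longleftrightarrow> (\<forall>k<m. \<forall>l<m. (\<Sum>i<N. c k i * M i l) = (if k = l then 1 else 0))"

text \<open>For fixed weights \<open>n\<close> the orthogonal projection onto the column space of \<open>M\<close> in weighted
  \<open>\<ell>\<^sub>2\<close> has weighted mean row sum at most \<open>\<mu>\<close>: repeating index \<open>j\<close> exactly \<open>n j\<close> times turns
  it into a competitor in the definition of \<open>\<mu>\<close>.\<close>

lemma weighted_projection:
  fixes n :: "nat \<Rightarrow> nat" and M :: "nat \<Rightarrow> nat \<Rightarrow> 'k"
  assumes n: "\<And>j. j < N \<Longrightarrow> n j \<ge> 1" and mT: "m \<le> (\<Sum>j<N. n j)"
    and indep: "full_column_rank N m M"
  obtains c where "left_inverse m N c M"
    and "(\<Sum>j<N. real (n j) * (\<Sum>i<N. norm (\<Sum>k<m. M j k * c k i))) \<le> real (\<Sum>j<N. n j) * mu_abs cj m"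
proof -
  have "\<forall>j<N. real (n j) > 0" using n by fastforce
  note gs = gram_schmidt[OF this indep]
  obtain V R R' where
    on': "\<forall>k<m. \<forall>l<m. (\<Sum>j<N. of_real (real (n j)) * (cj (V j k) * V j l)) = (if k = l then 1 else 0)"
    and VM: "\<forall>k<m. \<forall>j<N. V j k = (\<Sum>l<m. M j l * R k l)"
    and MV: "\<forall>k<m. \<forall>j<N. M j k = (\<Sum>l<m. V j l * R' k l)"
      using gs by (elim exE conjE) (rule that)
  have on: "(\<Sum>j<N. of_nat (n j) * (cj (V j k) * V j l)) = (if k = l then 1 else 0)" if "k < m" "l < m" for k l
    using on' that by simp
  have R: "V j k = (\<Sum>l<m. M j l * R k l)" if "k < m" "j < N" for k j using VM that by blast
  have R': "M j k = (\<Sum>l<m. V j l * R' k l)" if "k < m" "j < N" for k j using MV that by blast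
  \<comment> \<open>In matrix form \<open>c = R^T V^* D\<close> with \<open>D = diag (n)\<close>. As
    \<open>V = M R^T\<close>, this gives \<open>M c = V V^* D\<close>, the orthogonal projection for
    the weighted inner product.\<close>
  define c where "c k i = (\<Sum>l<m. R l k * (cj (V i l) * of_nat (n i)))" for k i
  have Mc: "(\<Sum>k<m. M j k * c k i) = (\<Sum>l<m. V j l * cj (V i l)) * of_nat (n i)" if j: "j < N" for j i
  proof -
    have "(\<Sum>k<m. M j k * c k i) = (\<Sum>k<m. \<Sum>l<m. M j k * R l k * (cj (V i l) * of_nat (n i)))"
      by (simp add: c_def sum_distrib_left mult.assoc)
    also have "\<dots> = (\<Sum>l<m. \<Sum>k<m. M j k * R l k * (cj (V i l) * of_nat (n i)))" by (rule sum.swap)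
    also have "\<dots> = (\<Sum>l<m. V j l * (cj (V i l) * of_nat (n i)))"
      using j by (simp add: R sum_distrib_right)
    finally show ?thesis by (simp add: sum_distrib_right mult.assoc)
  qed
  have cV: "(\<Sum>i<N. c k i * V i p) = R p k" if p: "p < m" for k p
  proof -
    have "(\<Sum>i<N. c k i * V i p) = (\<Sum>i<N. \<Sum>l<m. R l k * (of_nat (n i) * (cj (V i l) * V i p)))"
      by (simp add: c_def sum_distrib_right sum_distrib_left mult_ac)
    also have "\<dots> = (\<Sum>l<m. \<Sum>i<N. R l k * (of_nat (n i) * (cj (V i l) * V i p)))" by (rule sum.swap)
    also have "\<dots> = (\<Sum>l<m. R l k * (if l = p then 1 else 0))"
      using p by (simp add: on flip: sum_distrib_left)
    also have "\<dots> = R p k" using p by (simp add: if_distrib cong: if_cong)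
    finally show ?thesis .
  qed
  have cM: "(\<Sum>i<N. c k i * M i l) = (\<Sum>p<m. R p k * R' l p)" if l: "l < m" for k l
  proof -
    have "(\<Sum>i<N. c k i * M i l) = (\<Sum>i<N. \<Sum>p<m. c k i * V i p * R' l p)"
      using l by (simp add: R' sum_distrib_left mult.assoc)
    also have "\<dots> = (\<Sum>p<m. \<Sum>i<N. c k i * V i p * R' l p)" by (rule sum.swap)
    also have "\<dots> = (\<Sum>p<m. R p k * R' l p)" by (simp add: cV flip: sum_distrib_right)
    finally show ?thesis .
  qed
  have inv: "(\<Sum>p<m. R p k * R' l p) = (if k = l then 1 else 0)" if k: "k < m" and l: "l < m" for k l
  proof -
    \<comment> \<open>\<open>gram_schmidt\<close> does not state that the two base changes are
      mutually inverse. It follows here because \<open>M\<close> annihilates the difference and has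
      full column rank.\<close>
    have "(\<Sum>p<m. R p k * R' l p) - (if k = l then 1 else 0) = 0"
    proof (rule full_column_rankD[OF indep, where a = "\<lambda>k. (\<Sum>p<m. R p k * R' l p) - (if k = l then 1 else 0)"])
      fix j assume j: "j < N"
      have "M j l = (\<Sum>p<m. \<Sum>k<m. M j k * (R p k * R' l p))"
        using l j by (simp add: R' R sum_distrib_right mult.assoc)
      also have "\<dots> = (\<Sum>k<m. M j k * (\<Sum>p<m. R p k * R' l p))"
        by (subst sum.swap) (simp add: sum_distrib_left)
      finally have "M j l = (\<Sum>k<m. M j k * (\<Sum>p<m. R p k * R' l p))" .
      moreover have "(\<Sum>k<m. M j k * (if k = l then 1 else 0)) = M j l"
        using l by (simp add: if_distrib cong: if_cong)
      ultimately show "(\<Sum>k<m. M j k * ((\<Sum>p<m. R p k * R' l p) - (if k = l then 1 else 0))) = 0"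
        by (simp only: right_diff_distrib sum_subtractf) simp
    qed (rule k)
    thus ?thesis by simp
  qed
  define T where "T = (\<Sum>j<N. n j)"
  define g where "g = block_index n N"
  have sum_g: "(\<Sum>r<T. h (g r)) = (\<Sum>j<N. of_nat (n j) * h j)" for h :: "nat \<Rightarrow> 'k"
    unfolding T_def g_def by (rule sum_block_index)
  have sum_g': "(\<Sum>r<T. h (g r)) = (\<Sum>j<N. real (n j) * h j)" for h :: "nat \<Rightarrow> real"
    unfolding T_def g_def by (rule sum_block_index)
  \<comment> \<open>Since \<open>j\<close> occurs \<open>n j\<close> times, a plain sum over the
    \<open>T\<close> repetitions is already the weighted sum, with no factor
    \<open>sqrt (n j)\<close>. Of the two weights in the Gram mean below, one stays as the weight of
    the row and the other is absorbed into \<open>M c\<close>.\<close>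
  have "orthonormal_rows m T (\<lambda>l r. cj (V (g r) l))"
    unfolding orthonormal_rows_def
  proof (intro allI impI)
    fix a b assume "a < m" "b < m"
    thus "(\<Sum>r<T. cj (V (g r) a) * cj (cj (V (g r) b))) = (if a = b then 1 else 0)"
      using sum_g[of "\<lambda>j. cj (V j a) * V j b"] on by simp
  qed
  hence "gram_mean m T (\<lambda>l r. cj (V (g r) l)) \<le> mu_abs cj m"
    using mT by (intro gram_mean_le_mu_abs) (auto simp: T_def)
  moreover have "gram_mean m T (\<lambda>l r. cj (V (g r) l))
      = (1 / real T) * (\<Sum>j<N. real (n j) * (\<Sum>i<N. norm (\<Sum>k<m. M j k * c k i)))"
  proof -
    have "(\<Sum>r<T. \<Sum>r'<T. norm (\<Sum>l<m. V (g r) l * cj (V (g r') l)))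
        = (\<Sum>r<T. \<Sum>i<N. real (n i) * norm (\<Sum>l<m. V (g r) l * cj (V i l)))"
      by (intro sum.cong refl sum_g')
    also have "\<dots> = (\<Sum>j<N. real (n j) * (\<Sum>i<N. real (n i) * norm (\<Sum>l<m. V j l * cj (V i l))))"
      by (rule sum_g')
    also have "\<dots> = (\<Sum>j<N. real (n j) * (\<Sum>i<N. norm (\<Sum>k<m. M j k * c k i)))"
      by (intro sum.cong refl arg_cong2[of _ _ _ _ "(*)"]) (simp_all add: Mc norm_mult mult.commute)
    finally show ?thesis by (simp add: gram_mean_def)
  qed
  ultimately have "(1 / real T) * (\<Sum>j<N. real (n j) * (\<Sum>i<N. norm (\<Sum>k<m. M j k * c k i))) \<le> mu_abs cj m"
    by simp
  moreover have "T > 0 \<or> N = 0"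
  proof (cases "N = 0")
    case False
    hence "n 0 \<le> T" unfolding T_def by (intro member_le_sum) auto
    thus ?thesis using n[of 0] False by simp
  qed simp
  ultimately have TT: "(1 / real T) * (\<Sum>j<N. real (n j) * (\<Sum>i<N. norm (\<Sum>k<m. M j k * c k i)))
      \<le> mu_abs cj m" "T > 0 \<or> N = 0" by blast+
  from TT(2) have "(\<Sum>j<N. real (n j) * (\<Sum>i<N. norm (\<Sum>k<m. M j k * c k i))) \<le> real T * mu_abs cj m"
  proof
    assume "T > 0"
    with TT(1) show ?thesis by (simp add: field_simps)
  qed (simp add: T_def)
  moreover have "left_inverse m N c M" unfolding left_inverse_def using cM inv by simp
  ultimately show thesis using that[of c] by (simp add: T_def)
qed

end

section \<open>Separation of row-sum vectors\<close>

lemma real_carrier_space_fun: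
  "real_carrier_space UNIV (\<lambda>x y j. x j + y j) (\<lambda>_. 0) (\<lambda>r x j. r * x j :: real)"
  by unfold_locales (auto simp: algebra_simps)

context conj_field
begin

text \<open>The minimax principle: a projection that is good simultaneously for all rows exists since,
  by separation, otherwise some weighting of the rows would admit no good projection.\<close>

lemma minimax_projection:
  fixes M :: "nat \<Rightarrow> nat \<Rightarrow> 'k"
  assumes N: "N \<ge> 1" and e: "e > 0" and indep: "full_column_rank N m M"
  obtains c where "left_inverse m N c M"
    and "\<forall>j<N. (\<Sum>i<N. norm (\<Sum>k<m. M j k * c k i)) \<le> mu_abs cj m + e"
proof (rule ccontr)
  assume neg: "\<not> thesis"
  note witness = that
  define \<mu> where "\<mu> = mu_abs cj m"
  have \<mu>: "\<mu> \<ge> 0" unfolding \<mu>_def by (rule mu_abs_nonneg)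
  define F where "F c j = (\<Sum>i<N. norm (\<Sum>k<m. M j k * c k i))" for c j
  \<comment> \<open>The row sums are convex, not affine, in \<open>c\<close>; admitting every vector
    that dominates them makes \<open>C\<close> convex.\<close>
  define C where "C = {v :: nat \<Rightarrow> real. \<exists>c. left_inverse m N c M \<and> (\<forall>j<N. F c j \<le> v j)}"
  \<comment> \<open>The linear functionals below the maximum coordinate are exactly the averages
    with probability weights on the \<open>N\<close> rows; this is how separation yields
    weights.\<close>
  define p where "p v = Max (v ` {..<N})" for v :: "nat \<Rightarrow> real"
  have fin: "finite (v ` {..<N})" "v ` {..<N} \<noteq> {}" for v :: "nat \<Rightarrow> real" using N by (auto simp: lessThan_empty_iff)
  have p_ge: "v j \<le> p v" if "j < N" for v j unfolding p_def using that fin by (intro Max_ge) auto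
  have p_le: "p v \<le> r" if "\<And>j. j < N \<Longrightarrow> v j \<le> r" for v r
    unfolding p_def using that fin by (intro Max.boundedI) auto
  have p_att: "\<exists>j<N. p v = v j" for v using Max_in[OF fin(1) fin(2), of v] unfolding p_def by auto
  have F_nonneg: "F c j \<ge> 0" for c j unfolding F_def by (intro sum_nonneg) auto
  have avg: "\<exists>c. left_inverse m N c M \<and> (\<Sum>j<N. real (n j) * F c j) \<le> real (\<Sum>j<N. n j) * \<mu>"
    if n: "\<And>j. j < N \<Longrightarrow> n j \<ge> 1" "m \<le> (\<Sum>j<N. n j)" for n :: "nat \<Rightarrow> nat"
  proof -
    obtain c where "left_inverse m N c M"
      and "(\<Sum>j<N. real (n j) * (\<Sum>i<N. norm (\<Sum>k<m. M j k * c k i))) \<le> real (\<Sum>j<N. n j) * mu_abs cj m"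
      by (rule weighted_projection[OF n indep])
    thus ?thesis unfolding F_def \<mu>_def by (intro exI[of _ c] conjI)
  qed
  have ex: "\<exists>c. left_inverse m N c M"
  proof -
    \<comment> \<open>Any positive weights of total at least \<open>m\<close> would do to make
      \<open>C\<close> nonempty; the constant \<open>Suc m\<close> is such a choice.\<close>
    have "m \<le> N * Suc m" using N by (metis Suc_leD le_refl mult_le_mono mult_1)
    thus ?thesis using avg[of "\<lambda>_. Suc m"] by auto
  qed
  have beta: "\<mu> + e \<le> p v" if v: "v \<in> C" for v
  proof -
    obtain c where c: "left_inverse m N c M" "\<And>j. j < N \<Longrightarrow> F c j \<le> v j" using v unfolding C_def by auto
    have "\<exists>j<N. F c j > \<mu> + e"
    proof (rule ccontr)
      assume "\<not> (\<exists>j<N. F c j > \<mu> + e)"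
      hence "\<forall>j<N. F c j \<le> \<mu> + e" by (metis not_less)
      hence thesis unfolding F_def \<mu>_def by (rule witness[OF c(1)])
      thus False using neg by contradiction
    qed
    then obtain j where "j < N" "F c j > \<mu> + e" by blast
    thus ?thesis using c(2)[of j] p_ge[of j v] by linarith
  qed
  have conv: "(\<lambda>j. s * v j + t * u j) \<in> C"
    if vu: "v \<in> C" "u \<in> C" and st: "s \<ge> 0" "t \<ge> 0" "s + t = (1::real)" for v u s t
  proof -
    obtain c d where c: "left_inverse m N c M" "\<And>j. j < N \<Longrightarrow> F c j \<le> v j" and d: "left_inverse m N d M" "\<And>j. j < N \<Longrightarrow> F d j \<le> u j"
      using vu unfolding C_def by auto
    define b where "b k i = of_real s * c k i + of_real t * d k i" for k i
    have st1: "of_real s + of_real t = (1 :: 'k)" using st(3) by (metis of_real_1 of_real_add)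
    have "left_inverse m N b M" unfolding left_inverse_def
    proof (intro allI impI)
      fix k l assume kl: "k < m" "l < m"
      have "(\<Sum>i<N. b k i * M i l) = of_real s * (\<Sum>i<N. c k i * M i l) + of_real t * (\<Sum>i<N. d k i * M i l)"
        by (simp add: b_def algebra_simps sum.distrib sum_distrib_left)
      also have "\<dots> = (of_real s + of_real t) * (if k = l then 1 else 0)"
        using c(1) d(1) kl unfolding left_inverse_def by simp
      finally show "(\<Sum>i<N. b k i * M i l) = (if k = l then 1 else 0)" unfolding st1 by simp
    qed
    moreover have "F b j \<le> s * v j + t * u j" if j: "j < N" for j
    proof -
      have "F b j \<le> (\<Sum>i<N. s * norm (\<Sum>k<m. M j k * c k i) + t * norm (\<Sum>k<m. M j k * d k i))"
        unfolding F_def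
      proof (rule sum_mono)
        fix i
        have "(\<Sum>k<m. M j k * b k i)
            = of_real s * (\<Sum>k<m. M j k * c k i) + of_real t * (\<Sum>k<m. M j k * d k i)"
          by (simp add: b_def algebra_simps sum.distrib sum_distrib_left)
        hence "norm (\<Sum>k<m. M j k * b k i) \<le> norm (of_real s * (\<Sum>k<m. M j k * c k i))
            + norm (of_real t * (\<Sum>k<m. M j k * d k i))" by (simp only: norm_triangle_ineq)
        thus "norm (\<Sum>k<m. M j k * b k i)
            \<le> s * norm (\<Sum>k<m. M j k * c k i) + t * norm (\<Sum>k<m. M j k * d k i)"
          using st(1,2) by (simp only: norm_mult norm_of_real abs_of_nonneg)
      qed
      also have "\<dots> = s * F c j + t * F d j" by (simp add: F_def sum.distrib sum_distrib_left)
      also have "\<dots> \<le> s * v j + t * u j" using c(2)[OF j] d(2)[OF j] st by (intro add_mono mult_left_mono) auto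
      finally show ?thesis .
    qed
    ultimately show ?thesis unfolding C_def by (intro CollectI exI[of _ b]) auto
  qed
  interpret fs: real_carrier_space UNIV "\<lambda>x y j. x j + y j" "\<lambda>_. 0" "\<lambda>r x j. r * x j :: real"
    by (rule real_carrier_space_fun)
  have "\<exists>w. (\<forall>x\<in>UNIV. \<forall>y\<in>UNIV. w (\<lambda>j. x j + y j) = w x + w y) \<and>
    (\<forall>r. \<forall>x\<in>UNIV. w (\<lambda>j. r * x j) = r * w x) \<and> (\<forall>x\<in>UNIV. w x \<le> p x) \<and> (\<forall>c\<in>C. \<mu> + e \<le> w c)"
  proof (rule fs.mazur_orlicz[of p C "\<mu> + e"])
    show "p (\<lambda>j. x j + y j) \<le> p x + p y" for x y by (intro p_le add_mono p_ge)
    show "p (\<lambda>j. s * x j) = s * p x" if s: "s \<ge> 0" for s x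
    proof (rule antisym)
      show "p (\<lambda>j. s * x j) \<le> s * p x" using s by (intro p_le mult_left_mono p_ge)
      obtain j where "j < N" "p x = x j" using p_att by blast
      thus "s * p x \<le> p (\<lambda>j. s * x j)" using p_ge[of j "\<lambda>j. s * x j"] by simp
    qed
    show "C \<subseteq> UNIV" by simp
    show "C \<noteq> {}" using ex unfolding C_def by auto
    show "(\<lambda>j. s * c j + t * d j) \<in> C" if "c \<in> C" "d \<in> C" "s \<ge> 0" "t \<ge> 0" "s + t = 1" for c d s t
      using that by (rule conv)
    show "\<mu> + e \<le> p c" if "c \<in> C" for c using that by (rule beta)
  qed
  then obtain w where w: "\<forall>x\<in>UNIV. \<forall>y\<in>UNIV. w (\<lambda>j. x j + y j) = w x + w y"
    "\<forall>r. \<forall>x\<in>UNIV. w (\<lambda>j. r * x j) = r * w x" "\<forall>x\<in>UNIV. w x \<le> p x" "\<forall>c\<in>C. \<mu> + e \<le> w c"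
    by (elim exE conjE) (rule that)
  note w_add = w(1)[rule_format, OF UNIV_I UNIV_I] and w_sm = w(2)[rule_format, OF UNIV_I]
    and w_le = w(3)[rule_format, OF UNIV_I] and w_C = w(4)[rule_format]
  define E where "E j = (\<lambda>i. if i = j then 1 else 0 :: real)" for j :: nat
  define \<omega> where "\<omega> j = w (E j)" for j
  have \<omega>0: "\<omega> j \<ge> 0" for j
  proof -
    have "- \<omega> j = w (\<lambda>i. -1 * E j i)" unfolding w_sm \<omega>_def by simp
    also have "\<dots> \<le> 0" by (rule order_trans[OF w_le]) (auto intro!: p_le simp: E_def)
    finally show ?thesis by simp
  qed
  have w_sum: "w (\<lambda>i. \<Sum>j<K. f j i) = (\<Sum>j<K. w (f j))" for f and K :: nat
  proof (induction K)
    case 0 show ?case using w_sm[of 0 "\<lambda>_. 0"] by simp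
  qed (simp add: w_add)
  have w_eq: "w v = (\<Sum>j<N. \<omega> j * v j)" for v
  proof -
    \<comment> \<open>\<open>p\<close> sees only coordinates below \<open>N\<close>, so
      \<open>w\<close> is at most 0 on functions vanishing there. Applied to both differences of
      \<open>v\<close> and its truncation \<open>v'\<close>, this shows that \<open>w\<close>
      depends on these coordinates alone.\<close>
    have sup: "w u \<le> 0" if "\<And>j. j < N \<Longrightarrow> u j = 0" for u
      by (rule order_trans[OF w_le]) (simp add: p_le that)
    define v' where "v' i = (\<Sum>j<N. v j * E j i)" for i
    have v': "v' i = v i" if "i < N" for i
      using that by (simp add: v'_def E_def if_distrib cong: if_cong)
    have "w (\<lambda>i. v i + -1 * v' i) \<le> 0" "w (\<lambda>i. v' i + -1 * v i) \<le> 0" using v' by (auto intro!: sup)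
    hence "w v = w v'" unfolding w_add w_sm by simp
    also have "\<dots> = (\<Sum>j<N. w (\<lambda>i. v j * E j i))" unfolding v'_def by (rule w_sum)
    also have "\<dots> = (\<Sum>j<N. \<omega> j * v j)" by (simp add: w_sm \<omega>_def mult.commute)
    finally show ?thesis .
  qed
  have \<omega>1: "(\<Sum>j<N. \<omega> j) = 1"
  proof (rule antisym)
    have "w (\<lambda>_. 1) \<le> 1" by (rule order_trans[OF w_le]) (simp add: p_le)
    thus "(\<Sum>j<N. \<omega> j) \<le> 1" unfolding w_eq by simp
    have "w (\<lambda>_. -1) \<le> -1" by (rule order_trans[OF w_le]) (simp add: p_le)
    thus "1 \<le> (\<Sum>j<N. \<omega> j)" unfolding w_eq by (simp add: sum_negf)
  qed
  \<comment> \<open>Rounding adds at most \<open>2 * N\<close> to the total weight, hence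
    \<open>2 * N * \<mu>\<close> to the bound on the weighted row sums; the slack
    \<open>T * e\<close> has to exceed this. The maximum with \<open>m\<close> makes the repeated
    matrix wide enough.\<close>
  obtain T0 :: nat where T0: "real T0 > 2 * real N * \<mu> / e" using reals_Archimedean2 by blast
  define T where "T = max T0 m"
  have T: "real T * e > 2 * real N * \<mu>" "m \<le> T"
  proof -
    have "real T > 2 * real N * \<mu> / e" using T0 by (simp add: T_def)
    thus "real T * e > 2 * real N * \<mu>" using e by (simp add: field_simps)
  qed (simp add: T_def)
  \<comment> \<open>The extra 1 keeps the weight positive even where
    \<open>\<omega> j = 0\<close>.\<close>
  define n where "n j = nat \<lceil>real T * \<omega> j\<rceil> + 1" for j
  have n_ge: "real T * \<omega> j \<le> real (n j)" and n_le: "real (n j) \<le> real T * \<omega> j + 2" for j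
  proof -
    have "real T * \<omega> j \<ge> 0" using \<omega>0 by simp
    hence "real (n j) = of_int \<lceil>real T * \<omega> j\<rceil> + 1" unfolding n_def by simp
    thus "real T * \<omega> j \<le> real (n j)" "real (n j) \<le> real T * \<omega> j + 2"
      using le_of_int_ceiling[of "real T * \<omega> j"] of_int_ceiling_le_add_one[of "real T * \<omega> j"] by linarith+
  qed
  have Tsum: "(\<Sum>j<N. real T * \<omega> j) = real T" using \<omega>1 by (simp flip: sum_distrib_left)
  have S_ge: "real T \<le> real (\<Sum>j<N. n j)"
    unfolding of_nat_sum using sum_mono[of "{..<N}" "\<lambda>j. real T * \<omega> j" "\<lambda>j. real (n j)"] n_ge Tsum by simp
  have "real (\<Sum>j<N. n j) \<le> (\<Sum>j<N. real T * \<omega> j + 2)" unfolding of_nat_sum by (intro sum_mono n_le)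
  hence S_le: "real (\<Sum>j<N. n j) \<le> real T + 2 * real N" using Tsum by (simp add: sum.distrib)
  have "m \<le> (\<Sum>j<N. n j)" using S_ge T(2) by linarith
  then obtain c where c: "left_inverse m N c M" "(\<Sum>j<N. real (n j) * F c j) \<le> real (\<Sum>j<N. n j) * \<mu>"
    using avg[of n] by (auto simp: n_def)
  have "F c \<in> C" unfolding C_def using c(1) by auto
  hence "\<mu> + e \<le> (\<Sum>j<N. \<omega> j * F c j)" using w_C[of "F c"] by (simp only: w_eq)
  hence "real T * (\<mu> + e) \<le> real T * (\<Sum>j<N. \<omega> j * F c j)" by (intro mult_left_mono) auto
  also have "\<dots> = (\<Sum>j<N. real T * \<omega> j * F c j)" by (simp add: sum_distrib_left mult.assoc)
  also have "\<dots> \<le> (\<Sum>j<N. real (n j) * F c j)" by (intro sum_mono mult_right_mono n_ge F_nonneg)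
  also have "\<dots> \<le> (real T + 2 * real N) * \<mu>"
    using c(2) mult_right_mono[OF S_le \<mu>] by linarith
  finally show False using T(1) by (simp add: algebra_simps)
qed

end

section \<open>The upper bound\<close>

text \<open>Tychonoff's theorem for total functions. Coefficient vectors and frames are functions on
  \<open>nat\<close>, so their compactness is that of the product topology, used twice over for
  frames.\<close>

lemma compact_Pi_UNIV:
  fixes S :: "'i \<Rightarrow> 'a::topological_space set"
  assumes "\<And>i. compact (S i)"
  shows "compact (Pi UNIV S)"
proof -
  have "compactin (product_topology (\<lambda>_. euclidean) UNIV) (PiE UNIV S)"
    unfolding compactin_PiE using assms by simp
  thus ?thesis by (simp add: euclidean_product_topology PiE_UNIV_domain)
qed

lemma continuous_on_coord2 [continuous_intros]:
  "continuous_on A (\<lambda>V :: 'a \<Rightarrow> 'b \<Rightarrow> 'c::topological_space. V k j)"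
proof -
  have "continuous_on UNIV (\<lambda>V :: 'a \<Rightarrow> 'b \<Rightarrow> 'c. V k j)"
    by (rule continuous_on_product_then_coordinatewise[OF continuous_on_product_coordinates])
  thus ?thesis by (rule continuous_on_subset) simp
qed

section \<open>Linear combinations and norming families\<close>

context conj_banach
begin

lemma lincomb_in: "(\<And>k. k < n \<Longrightarrow> b k \<in> ns_carrier X) \<Longrightarrow> lincomb X c b n \<in> ns_carrier X"
  by (induction n) (auto simp: zero_in add_in smult_in)

lemma lincomb_cong: "(\<And>k. k < n \<Longrightarrow> c k = d k) \<Longrightarrow> lincomb X c b n = lincomb X d b n"
  by (induction n) auto

lemma lincomb_add:
  "(\<And>k. k < n \<Longrightarrow> b k \<in> ns_carrier X) \<Longrightarrow>
    lincomb X (\<lambda>k. c k + d k) b n = ns_add X (lincomb X c b n) (lincomb X d b n)"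
  by (induction n) (simp_all add: zero_in add_zero smult_add_left add_interchange lincomb_in smult_in)

lemma lincomb_smult:
  "(\<And>k. k < n \<Longrightarrow> b k \<in> ns_carrier X) \<Longrightarrow>
    lincomb X (\<lambda>k. a * c k) b n = ns_smult X a (lincomb X c b n)"
  by (induction n) (simp_all add: smult_zero smult_add_right smult_smult lincomb_in smult_in)

lemma norm_lincomb_le:
  "(\<And>k. k < n \<Longrightarrow> b k \<in> ns_carrier X) \<Longrightarrow>
    ns_norm X (lincomb X c b n) \<le> (\<Sum>k<n. norm (c k) * ns_norm X (b k))"
proof (induction n)
  case 0
  show ?case using nn_eq_0[OF zero_in] by simp
next
  case (Suc n)
  have "ns_norm X (lincomb X c b (Suc n)) \<le> ns_norm X (lincomb X c b n) + ns_norm X (ns_smult X (c n) (b n))"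
    using Suc.prems by (simp add: nn_add lincomb_in smult_in)
  thus ?case using Suc by (simp add: nn_smult)
qed

lemma klinear_add: "\<lbrakk>klinear f; x \<in> ns_carrier X; y \<in> ns_carrier X\<rbrakk> \<Longrightarrow> f (ns_add X x y) = f x + f y"
  and klinear_smult: "\<lbrakk>klinear f; x \<in> ns_carrier X\<rbrakk> \<Longrightarrow> f (ns_smult X a x) = a * f x"
  by (simp_all add: klinear_def)

lemma klinear_lincomb:
  assumes f: "klinear f" and b: "\<And>k. k < n \<Longrightarrow> b k \<in> ns_carrier X"
  shows "f (lincomb X c b n) = (\<Sum>k<n. c k * f (b k))"
  using b
proof (induction n)
  case 0
  show ?case using klinear_smult[OF f zero_in, of 0] by (simp add: smult_zero)
next
  case (Suc n)
  thus ?case using f by (simp add: klinear_add klinear_smult lincomb_in smult_in)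
qed

text \<open>The triangle inequality in both directions bounds the variation by \<open>H\<close>, a
  sum over finitely many coordinates and therefore continuous in the product topology.\<close>

lemma continuous_on_norm_lincomb:
  assumes b: "\<And>k. k < m \<Longrightarrow> b k \<in> ns_carrier X"
  shows "continuous_on UNIV (\<lambda>a. ns_norm X (lincomb X a b m))"
proof -
  define G where "G a = ns_norm X (lincomb X a b m)" for a
  define H where "H a' a = (\<Sum>k<m. norm (a k - a' k) * ns_norm X (b k))" for a a' :: "nat \<Rightarrow> 'k"
  have GH: "G a \<le> G a' + H a' a" for a a'
  proof -
    have "lincomb X a b m = lincomb X (\<lambda>k. a' k + (a k - a' k)) b m" by (intro lincomb_cong) simp
    also have "\<dots> = ns_add X (lincomb X a' b m) (lincomb X (\<lambda>k. a k - a' k) b m)"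
      using b by (rule lincomb_add)
    finally have "G a \<le> G a' + ns_norm X (lincomb X (\<lambda>k. a k - a' k) b m)"
      unfolding G_def using b by (simp add: nn_add lincomb_in)
    also have "ns_norm X (lincomb X (\<lambda>k. a k - a' k) b m) \<le> H a' a"
      unfolding H_def using b by (rule norm_lincomb_le)
    finally show ?thesis by simp
  qed
  have H_sym: "H a' a = H a a'" for a a' by (simp add: H_def norm_minus_commute)
  have "(G \<longlongrightarrow> G a') (at a')" for a'
  proof (rule LIM_zero_cancel, rule Lim_null_comparison)
    show "\<forall>\<^sub>F a in at a'. norm (G a - G a') \<le> H a' a"
    proof (rule always_eventually, rule allI)
      fix a
      have "G a \<le> G a' + H a' a" "G a' \<le> G a + H a' a" using GH[of a a'] GH[of a' a] H_sym by auto
      thus "norm (G a - G a') \<le> H a' a" by simp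
    qed
    have "continuous_on UNIV (H a')" unfolding H_def by (intro continuous_intros) auto
    hence "(H a' \<longlongrightarrow> H a' a') (at a')" by (simp add: continuous_on_def)
    thus "(H a' \<longlongrightarrow> 0) (at a')" by (simp add: H_def)
  qed
  thus ?thesis by (simp add: continuous_on_def G_def[abs_def])
qed

text \<open>A functional that norms one vector still norms its neighbours up to the factor
  \<open>1 - d\<close>. Compactness of the unit sphere of the coefficient space leaves finitely many
  functionals, and homogeneity extends the estimate from the sphere to all coefficients.\<close>

lemma norming_family:
  assumes m: "m \<ge> 1" and b': "\<forall>k<m. b k \<in> ns_carrier X"
    and indep: "\<forall>c. lincomb X c b m = ns_zero X \<longrightarrow> (\<forall>k<m. c k = 0)" and d: "d > 0"
  obtains f and N :: nat where "N \<ge> 1" "\<forall>j<N. klinear (f j)"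
    "\<forall>j<N. \<forall>x\<in>ns_carrier X. norm (f j x) \<le> ns_norm X x"
    "\<forall>a. \<exists>j<N. (1 - d) * ns_norm X (lincomb X a b m) \<le> norm (f j (lincomb X a b m))"
proof -
  have b: "b k \<in> ns_carrier X" if "k < m" for k using b' that by blast
  define L where "L a = lincomb X a b m" for a
  \<comment> \<open>Entries from \<open>m\<close> on are fixed to 0: with free entries the set would
    not be compact in the product topology.\<close>
  define S where "S = {a :: nat \<Rightarrow> 'k. (\<forall>k\<ge>m. a k = 0) \<and> (\<Sum>k<m. norm (a k)) = 1}"
  define \<F> where "\<F> = {f. klinear f \<and> (\<forall>x\<in>ns_carrier X. norm (f x) \<le> ns_norm X x)}"
  \<comment> \<open>Independence makes \<open>ns_norm X (L a)\<close> positive on \<open>S\<close>,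
    so the slack \<open>d\<close> turns the norming inequality into a strict one and the sets
    \<open>Q f\<close> into an open cover.\<close>
  define Q where "Q f = {a. (1 - d) * ns_norm X (L a) < norm (\<Sum>k<m. a k * f (b k))}" for f :: "'v \<Rightarrow> 'k"
  have L_in: "L a \<in> ns_carrier X" for a unfolding L_def using b by (rule lincomb_in)
  have fL: "f (L a) = (\<Sum>k<m. a k * f (b k))" if "f \<in> \<F>" for f a
    unfolding L_def using that b by (intro klinear_lincomb) (auto simp: \<F>_def)
  have coord: "continuous_on UNIV (\<lambda>a :: nat \<Rightarrow> 'k. a k)" for k by simp
  have "compact S"
  proof -
    define K where "K = Pi UNIV (\<lambda>_::nat. cball (0::'k) 1)"
    have "S = K \<inter> ((\<Inter>k\<in>{m..}. {a. a k = 0}) \<inter> {a. (\<Sum>k<m. norm (a k)) = 1})"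
    proof -
      have "norm (a k) \<le> 1" if "a \<in> S" for a k
      proof (cases "k < m")
        case True
        have "norm (a k) \<le> (\<Sum>k<m. norm (a k))" using True by (intro member_le_sum) auto
        thus ?thesis using that by (simp add: S_def)
      next
        case False thus ?thesis using that by (simp add: S_def)
      qed
      thus ?thesis by (auto simp: S_def K_def)
    qed
    moreover have "closed ((\<Inter>k\<in>{m..}. {a :: nat \<Rightarrow> 'k. a k = 0}) \<inter> {a. (\<Sum>k<m. norm (a k)) = 1})"
      by (intro closed_Int closed_INT ballI closed_Collect_eq continuous_intros coord)
    moreover have "compact K" unfolding K_def by (intro compact_Pi_UNIV compact_cball)
    ultimately show ?thesis by (simp add: compact_Int_closed)
  qed
  moreover have "open (Q f)" for f
  proof -
    have "continuous_on UNIV (\<lambda>a. ns_norm X (L a))"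
      unfolding L_def using b by (rule continuous_on_norm_lincomb)
    thus ?thesis unfolding Q_def by (intro open_Collect_less continuous_intros coord)
  qed
  moreover have "S \<subseteq> (\<Union>f\<in>\<F>. Q f)"
  proof
    fix a assume a: "a \<in> S"
    obtain f where f: "klinear f" "\<And>x. x \<in> ns_carrier X \<Longrightarrow> norm (f x) \<le> ns_norm X x"
      "ns_norm X (L a) \<le> norm (f (L a))" using norming_functional[OF L_in[of a]] by metis
    have fF: "f \<in> \<F>" using f by (simp add: \<F>_def)
    have "L a \<noteq> ns_zero X"
    proof
      assume "L a = ns_zero X"
      hence "\<forall>k<m. a k = 0" using indep unfolding L_def by blast
      thus False using a by (simp add: S_def)
    qed
    hence "ns_norm X (L a) > 0" using nn_nonneg[OF L_in[of a]] nn_eq_0[OF L_in[of a]] by linarith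
    hence "(1 - d) * ns_norm X (L a) < ns_norm X (L a)" using d by (simp add: algebra_simps)
    hence "a \<in> Q f" using f(3) fL[OF fF] by (simp add: Q_def)
    thus "a \<in> (\<Union>f\<in>\<F>. Q f)" using fF by blast
  qed
  ultimately obtain D where D: "D \<subseteq> \<F>" "finite D" "S \<subseteq> (\<Union>f\<in>D. Q f)"
    by (rule compactE_image)
  obtain xs where xs: "set xs = D" using finite_list[OF D(2)] by blast
  have xsF: "xs ! j \<in> \<F>" if "j < length xs" for j using that xs D(1) nth_mem by blast
  have S_case: "\<exists>j<length xs. (1 - d) * ns_norm X (L a) \<le> norm ((xs ! j) (L a))" if a: "a \<in> S" for a
  proof -
    obtain f where f: "f \<in> D" "a \<in> Q f" using D(3) a by blast
    then obtain j where j: "j < length xs" "f = xs ! j" using xs by (metis in_set_conv_nth)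
    have "(1 - d) * ns_norm X (L a) < norm (f (L a))"
      using f fL[of f a] D(1) by (auto simp: Q_def)
    thus ?thesis using j by (intro exI[of _ j]) simp
  qed
  have "(\<lambda>k. if k = 0 then 1 else 0) \<in> S"
    using m by (auto simp: S_def if_distrib[of norm] cong: if_cong)
  hence N: "length xs \<ge> 1" using S_case by force
  have all: "\<exists>j<length xs. (1 - d) * ns_norm X (L a) \<le> norm ((xs ! j) (L a))" for a
  \<comment> \<open>The zero vector cannot be scaled into \<open>S\<close>, but for it any index
    serves, and the family is nonempty.\<close>
  proof (cases "\<forall>k<m. a k = 0")
    case True
    hence "L a = lincomb X (\<lambda>k. 0 * a k) b m" unfolding L_def by (intro lincomb_cong) simp
    also have "\<dots> = ns_smult X 0 (L a)" unfolding L_def using b by (rule lincomb_smult)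
    also have "\<dots> = ns_zero X" by (rule smult_0[OF L_in])
    finally have "ns_norm X (L a) = 0" using nn_eq_0[OF zero_in] by simp
    thus ?thesis using N by (intro exI[of _ 0]) auto
  next
    case False
    define s where "s = (\<Sum>k<m. norm (a k))"
    obtain k where k: "k < m" "a k \<noteq> 0" using False by blast
    have "norm (a k) \<le> s" unfolding s_def using k by (intro member_le_sum) auto
    hence s: "s > 0" using k(2) by (smt (verit) zero_less_norm_iff)
    define a' where "a' k = (if k < m then of_real (1 / s) * a k else 0)" for k
    have "(\<Sum>k<m. norm (a' k)) = (\<Sum>k<m. norm (a k)) / s"
      using s by (simp add: a'_def norm_mult norm_divide sum_divide_distrib)
    hence "a' \<in> S" using s by (simp add: S_def s_def[symmetric] a'_def)
    then obtain j where j: "j < length xs" "(1 - d) * ns_norm X (L a') \<le> norm ((xs ! j) (L a'))"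
      using S_case by blast
    have "L a' = lincomb X (\<lambda>k. of_real (1 / s) * a k) b m"
      unfolding L_def by (intro lincomb_cong) (simp add: a'_def)
    also have "\<dots> = ns_smult X (of_real (1 / s)) (L a)" unfolding L_def using b by (rule lincomb_smult)
    finally have La': "L a' = ns_smult X (of_real (1 / s)) (L a)" .
    have "klinear (xs ! j)" using xsF[OF j(1)] by (simp add: \<F>_def)
    hence "(xs ! j) (L a') = of_real (1 / s) * (xs ! j) (L a)"
      unfolding La' by (rule klinear_smult[OF _ L_in])
    moreover have "ns_norm X (L a') = (1 / s) * ns_norm X (L a)"
      unfolding La' using s by (simp add: nn_smult L_in norm_divide)
    ultimately have "(1 / s) * ((1 - d) * ns_norm X (L a)) \<le> (1 / s) * norm ((xs ! j) (L a))"
      using j(2) s by (simp add: norm_mult norm_divide)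
    hence "(1 - d) * ns_norm X (L a) \<le> norm ((xs ! j) (L a))"
      using s by (subst (asm) mult_le_cancel_left_pos) auto
    thus ?thesis using j(1) by blast
  qed
  show thesis
  proof (rule that[of "length xs" "\<lambda>j. xs ! j"])
    show "length xs \<ge> 1" by (rule N)
    show "\<forall>j<length xs. klinear (xs ! j)" using xsF by (simp add: \<F>_def)
    show "\<forall>j<length xs. \<forall>x\<in>ns_carrier X. norm ((xs ! j) x) \<le> ns_norm X x"
      using xsF by (simp add: \<F>_def)
    show "\<forall>a. \<exists>j<length xs. (1 - d) * ns_norm X (lincomb X a b m) \<le> norm ((xs ! j) (lincomb X a b m))"
      using all unfolding L_def by blast
  qed
qed

section \<open>Operator norms and the projection built from a matrix\<close>

lemma op_norm_bdd:
  assumes "is_proj X Y P"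
  shows "bdd_above {ns_norm X (P x) | x. x \<in> ns_carrier X \<and> ns_norm X x \<le> 1}"
proof -
  obtain C where C: "\<forall>x\<in>ns_carrier X. ns_norm X (P x) \<le> C * ns_norm X x"
    using assms unfolding is_proj_def by blast
  have "ns_norm X (P x) \<le> \<bar>C\<bar>" if "x \<in> ns_carrier X" "ns_norm X x \<le> 1" for x
  proof -
    have "ns_norm X (P x) \<le> C * ns_norm X x" using C that(1) by blast
    also have "\<dots> \<le> \<bar>C\<bar> * 1"
      using that nn_nonneg by (intro mult_mono) auto
    finally show ?thesis by simp
  qed
  thus ?thesis by (intro bdd_aboveI[of _ "\<bar>C\<bar>"]) blast
qed

lemma norm_le_op_norm:
  "\<lbrakk>is_proj X Y P; x \<in> ns_carrier X; ns_norm X x \<le> 1\<rbrakk> \<Longrightarrow> ns_norm X (P x) \<le> op_norm X P"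
  unfolding op_norm_def by (rule cSup_upper[OF _ op_norm_bdd]) auto

lemma op_norm_nonneg:
  assumes P: "is_proj X Y P" and Y: "Y \<subseteq> ns_carrier X"
  shows "0 \<le> op_norm X P"
proof -
  have "P (ns_zero X) \<in> ns_carrier X" using P Y zero_in unfolding is_proj_def by blast
  hence "0 \<le> ns_norm X (P (ns_zero X))" by (rule nn_nonneg)
  also have "\<dots> \<le> op_norm X P"
    using nn_eq_0[OF zero_in] by (intro norm_le_op_norm[OF P zero_in]) simp
  finally show ?thesis .
qed

text \<open>The functionals \<open>f j\<close> map \<open>Y\<close> onto the column space of
  \<open>M\<close>, onto which \<open>M c\<close> projects. As they are defined on all of
  \<open>X\<close>, the coefficients \<open>\<phi>\<close> transport \<open>M c\<close> back to a
  projection \<open>P\<close> of \<open>X\<close>, whose norm is at most the largest row sum divided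
  by \<open>1 - e\<close>.\<close>

theorem rel_proj_const_le_mu_abs:
  assumes m: "m \<ge> 1" and Y: "fin_subspace X Y m"
  shows "rel_proj_const X Y \<le> mu_abs cj m"
proof -
  obtain b where b': "\<forall>k<m. b k \<in> ns_carrier X"
    and indep': "\<forall>c. lincomb X c b m = ns_zero X \<longrightarrow> (\<forall>k<m. c k = 0)"
    and Y_eq: "Y = {lincomb X c b m | c. True}"
    using Y unfolding fin_subspace_def by (elim exE conjE) (rule that)
  have b: "b k \<in> ns_carrier X" if "k < m" for k using b' that by blast
  have indep: "\<forall>k<m. c k = 0" if "lincomb X c b m = ns_zero X" for c using indep' that by blast
  have Y_sub: "Y \<subseteq> ns_carrier X" unfolding Y_eq using b by (auto intro: lincomb_in)
  have bdd: "bdd_below (op_norm X ` {P. is_proj X Y P})"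
    using op_norm_nonneg Y_sub by (intro bdd_belowI2[of _ 0]) auto
  define \<rho> where "\<rho> = rel_proj_const X Y"
  define \<mu> where "\<mu> = mu_abs cj m"
  have \<mu>: "\<mu> \<ge> 0" unfolding \<mu>_def by (rule mu_abs_nonneg)
  have main: "(1 - e) * \<rho> \<le> \<mu> + e" if e: "0 < e" "e < 1" for e
  proof -
    obtain f and N :: nat where N: "N \<ge> 1" and f': "\<forall>j<N. klinear (f j)"
      and f_le: "\<forall>j<N. \<forall>x\<in>ns_carrier X. norm (f j x) \<le> ns_norm X x"
      and f_norming: "\<forall>a. \<exists>j<N. (1 - e) * ns_norm X (lincomb X a b m) \<le> norm (f j (lincomb X a b m))"
      by (rule norming_family[OF m b' indep' e(1)])
    have f: "klinear (f j)" if "j < N" for j using f' that by blast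
    define M where "M j k = f j (b k)" for j k
    have fL: "f j (lincomb X a b m) = (\<Sum>k<m. M j k * a k)" if "j < N" for j a
      unfolding M_def using klinear_lincomb[OF f[OF that] b] by (simp add: mult.commute)
    have "full_column_rank N m M"
      unfolding full_column_rank_def
    proof (intro allI impI)
      fix a k assume a: "\<forall>j<N. (\<Sum>k<m. M j k * a k) = 0" and k: "k < m"
      obtain j where "j < N" "(1 - e) * ns_norm X (lincomb X a b m) \<le> norm (f j (lincomb X a b m))"
        using f_norming by blast
      hence "(1 - e) * ns_norm X (lincomb X a b m) \<le> 0" using a fL by simp
      hence "ns_norm X (lincomb X a b m) \<le> 0" using e by (simp add: mult_le_0_iff)
      hence "lincomb X a b m = ns_zero X"
        using nn_nonneg[OF lincomb_in[OF b]] nn_eq_0[OF lincomb_in[OF b]] by (meson antisym)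
      thus "a k = 0" using indep k by blast
    qed
    from minimax_projection[OF N e(1) this] obtain c where c: "left_inverse m N c M"
      and c_le': "\<forall>j<N. (\<Sum>i<N. norm (\<Sum>k<m. M j k * c k i)) \<le> mu_abs cj m + e" .
    have c_le: "(\<Sum>i<N. norm (\<Sum>k<m. M j k * c k i)) \<le> \<mu> + e" if "j < N" for j
      using c_le' that unfolding \<mu>_def by blast
    define \<phi> where "\<phi> x k = (\<Sum>i<N. c k i * f i x)" for x k
    define P where "P x = lincomb X (\<phi> x) b m" for x
    have P_norm: "(1 - e) * ns_norm X (P x) \<le> (\<mu> + e) * ns_norm X x" if x: "x \<in> ns_carrier X" for x
    proof -
      \<comment> \<open>The index norms \<open>P x\<close>, not \<open>x\<close>, so that only row
        \<open>j\<close> of \<open>M c\<close> enters; on \<open>x\<close> itself every functional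
        is bounded by the norm.\<close>
      obtain j where j: "j < N" "(1 - e) * ns_norm X (P x) \<le> norm (f j (P x))"
        using f_norming unfolding P_def by blast
      have "f j (P x) = (\<Sum>k<m. \<Sum>i<N. M j k * c k i * f i x)"
        unfolding P_def fL[OF j(1)] by (simp add: \<phi>_def sum_distrib_left mult.assoc)
      also have "\<dots> = (\<Sum>i<N. (\<Sum>k<m. M j k * c k i) * f i x)"
        by (subst sum.swap) (simp add: sum_distrib_right)
      finally have "norm (f j (P x)) \<le> (\<Sum>i<N. norm ((\<Sum>k<m. M j k * c k i) * f i x))"
        by (simp add: norm_sum)
      also have "\<dots> \<le> (\<Sum>i<N. norm (\<Sum>k<m. M j k * c k i) * ns_norm X x)"
        unfolding norm_mult using f_le x by (intro sum_mono mult_left_mono) auto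
      also have "\<dots> = (\<Sum>i<N. norm (\<Sum>k<m. M j k * c k i)) * ns_norm X x"
        by (simp add: sum_distrib_right)
      also have "\<dots> \<le> (\<mu> + e) * ns_norm X x" using c_le[OF j(1)] nn_nonneg[OF x] by (rule mult_right_mono)
      finally show ?thesis using j(2) by linarith
    qed
    have P_norm': "ns_norm X (P x) \<le> (\<mu> + e) / (1 - e) * ns_norm X x" if "x \<in> ns_carrier X" for x
      using P_norm[OF that] e by (simp add: field_simps)
    have "is_proj X Y P"
      unfolding is_proj_def
    proof (intro conjI ballI allI)
      show "P x \<in> Y" for x unfolding Y_eq P_def by blast
      show "P (ns_add X x y) = ns_add X (P x) (P y)" if "x \<in> ns_carrier X" "y \<in> ns_carrier X" for x y
      proof -
        have "P (ns_add X x y) = lincomb X (\<lambda>k. \<phi> x k + \<phi> y k) b m"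
          unfolding P_def using that f
          by (intro lincomb_cong) (simp add: \<phi>_def klinear_add distrib_left sum.distrib)
        also have "\<dots> = ns_add X (P x) (P y)" unfolding P_def using b by (rule lincomb_add)
        finally show ?thesis .
      qed
      show "P (ns_smult X a x) = ns_smult X a (P x)" if "x \<in> ns_carrier X" for a x
      proof -
        have "P (ns_smult X a x) = lincomb X (\<lambda>k. a * \<phi> x k) b m"
          unfolding P_def using that f
          by (intro lincomb_cong) (simp add: \<phi>_def klinear_smult sum_distrib_left mult.left_commute)
        also have "\<dots> = ns_smult X a (P x)" unfolding P_def using b by (rule lincomb_smult)
        finally show ?thesis .
      qed
      show "\<exists>C. \<forall>x\<in>ns_carrier X. ns_norm X (P x) \<le> C * ns_norm X x" using P_norm' by blast
      fix y assume "y \<in> Y"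
      then obtain a where y: "y = lincomb X a b m" unfolding Y_eq by blast
      have "\<phi> y k = a k" if k: "k < m" for k
      proof -
        have "\<phi> y k = (\<Sum>i<N. \<Sum>l<m. c k i * M i l * a l)"
          unfolding \<phi>_def y by (simp add: fL sum_distrib_left mult.assoc)
        also have "\<dots> = (\<Sum>l<m. (\<Sum>i<N. c k i * M i l) * a l)"
          by (subst sum.swap) (simp add: sum_distrib_right)
        also have "\<dots> = (\<Sum>l<m. if k = l then a l else 0)"
          using c k unfolding left_inverse_def by (intro sum.cong) auto
        also have "\<dots> = a k" using k by simp
        finally show ?thesis .
      qed
      thus "P y = y" unfolding P_def y by (intro lincomb_cong) (simp add: y)
    qed
    hence "\<rho> \<le> op_norm X P" unfolding \<rho>_def rel_proj_const_def using bdd by (intro cInf_lower) auto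
    also have "op_norm X P \<le> (\<mu> + e) / (1 - e)"
      unfolding op_norm_def
    proof (rule cSup_least)
      show "{ns_norm X (P x) |x. x \<in> ns_carrier X \<and> ns_norm X x \<le> 1} \<noteq> {}"
        using zero_in nn_eq_0[OF zero_in] by (auto intro!: exI[of _ "ns_zero X"])
      fix r assume "r \<in> {ns_norm X (P x) |x. x \<in> ns_carrier X \<and> ns_norm X x \<le> 1}"
      then obtain x where x: "r = ns_norm X (P x)" "x \<in> ns_carrier X" "ns_norm X x \<le> 1" by blast
      have "r \<le> (\<mu> + e) / (1 - e) * ns_norm X x" using P_norm' x by simp
      also have "\<dots> \<le> (\<mu> + e) / (1 - e) * 1" using x e \<mu> by (intro mult_left_mono) auto
      finally show "r \<le> (\<mu> + e) / (1 - e)" by simp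
    qed
    finally show ?thesis using e by (simp add: field_simps)
  qed
  have "\<rho> \<le> \<mu>"
  proof (rule ccontr)
    assume "\<not> \<rho> \<le> \<mu>"
    hence r: "\<rho> > \<mu>" by simp
    \<comment> \<open>Chosen so that \<open>e * (1 + \<rho>)\<close> is half of the gap
      \<open>\<rho> - \<mu>\<close>, while \<open>main\<close> forces it to be at least the whole
      gap.\<close>
    define e where "e = (\<rho> - \<mu>) / (2 * (1 + \<rho>))"
    have e: "0 < e" "e < 1" and e2: "e * (1 + \<rho>) = (\<rho> - \<mu>) / 2"
      using r \<mu> by (auto simp: e_def field_simps)
    have "(1 - e) * \<rho> \<le> \<mu> + e" using e by (rule main)
    hence "\<rho> - \<mu> \<le> e * (1 + \<rho>)" by (simp add: algebra_simps)
    thus False using r e2 by simp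
  qed
  thus ?thesis by (simp add: \<rho>_def \<mu>_def)
qed

end

section \<open>The lower bound\<close>

context conj_field
begin

definition ip :: "nat \<Rightarrow> (nat \<Rightarrow> 'k) \<Rightarrow> (nat \<Rightarrow> 'k) \<Rightarrow> 'k" where
  "ip N x y = (\<Sum>i<N. cj (x i) * y i)"

definition matvec :: "nat \<Rightarrow> (nat \<Rightarrow> nat \<Rightarrow> 'k) \<Rightarrow> (nat \<Rightarrow> 'k) \<Rightarrow> nat \<Rightarrow> 'k" where
  "matvec N B x i = (\<Sum>j<N. B i j * x j)"

lemma ip_add_right: "ip N x (\<lambda>i. y i + z i) = ip N x y + ip N x z"
  by (simp add: ip_def distrib_left sum.distrib)

lemma ip_diff_right: "ip N x (\<lambda>i. y i - z i) = ip N x y - ip N x z"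
  by (simp add: ip_def right_diff_distrib sum_subtractf)

lemma ip_scale_right: "ip N x (\<lambda>i. a * y i) = a * ip N x y"
  by (simp add: ip_def sum_distrib_left mult.left_commute)

lemma ip_sum_right: "ip N x (\<lambda>i. \<Sum>l<m. f l i) = (\<Sum>l<m. ip N x (f l))"
  by (simp add: ip_def sum_distrib_left sum.swap[of _ "{..<m}"])

lemma cj_ip: "cj (ip N x y) = ip N y x"
  by (simp add: ip_def cj_sum cj_mult mult.commute)

lemma ip_add_left: "ip N (\<lambda>i. x i + y i) z = ip N x z + ip N y z"
  by (simp add: ip_def cj_add distrib_right sum.distrib)

lemma ip_scale_left: "ip N (\<lambda>i. a * x i) y = cj a * ip N x y"
  by (simp add: ip_def cj_mult sum_distrib_left mult.assoc)

lemma ip_self: "ip N x x = of_real (\<Sum>i<N. (norm (x i))\<^sup>2)"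
  by (simp only: ip_def cj_mult_self of_real_sum)

lemma ip_cong: "\<lbrakk>\<And>i. i < N \<Longrightarrow> x i = x' i; \<And>i. i < N \<Longrightarrow> y i = y' i\<rbrakk> \<Longrightarrow> ip N x y = ip N x' y'"
  by (simp add: ip_def)

lemma matvec_add: "matvec N B (\<lambda>j. x j + y j) = (\<lambda>i. matvec N B x i + matvec N B y i)"
  by (simp add: matvec_def distrib_left sum.distrib fun_eq_iff)

lemma matvec_scale: "matvec N B (\<lambda>j. a * x j) = (\<lambda>i. a * matvec N B x i)"
  by (simp add: matvec_def sum_distrib_left mult.left_commute fun_eq_iff)

lemma matvec_cong: "(\<And>j. j < N \<Longrightarrow> x j = y j) \<Longrightarrow> matvec N B x = matvec N B y"
  by (simp add: matvec_def fun_eq_iff)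

lemma ip_matvec:
  assumes "\<And>i j. \<lbrakk>i < N; j < N\<rbrakk> \<Longrightarrow> B j i = cj (B i j)"
  shows "ip N x (matvec N B y) = ip N (matvec N B x) y"
proof -
  have "ip N x (matvec N B y) = (\<Sum>i<N. \<Sum>j<N. cj (x i) * B i j * y j)"
    by (simp add: ip_def matvec_def sum_distrib_left mult.assoc)
  also have "\<dots> = (\<Sum>j<N. \<Sum>i<N. cj (x i) * B i j * y j)" by (rule sum.swap)
  also have "\<dots> = (\<Sum>j<N. \<Sum>i<N. cj (B j i * x i) * y j)"
  proof (intro sum.cong refl)
    fix i j assume "j \<in> {..<N}" "i \<in> {..<N}"
    hence "B i j = cj (B j i)" by (intro assms) auto
    thus "cj (x i) * B i j * y j = cj (B j i * x i) * y j" by (simp add: cj_mult mult.commute)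
  qed
  also have "\<dots> = ip N (matvec N B x) y"
    by (simp add: ip_def matvec_def cj_sum sum_distrib_right)
  finally show ?thesis .
qed

lemma orthonormal_rows_iff:
  "orthonormal_rows m N V \<longleftrightarrow> (\<forall>a<m. \<forall>b<m. ip N (V a) (V b) = (if a = b then 1 else 0))"
  unfolding orthonormal_rows_def ip_def by (auto simp: mult.commute)

lemma ip_orthonormal_sum:
  assumes "orthonormal_rows m N V" "k < m"
  shows "ip N (V k) (\<lambda>i. \<Sum>l<m. h l * V l i) = h k"
proof -
  have "ip N (V k) (\<lambda>i. \<Sum>l<m. h l * V l i) = (\<Sum>l<m. h l * ip N (V k) (V l))"
    by (simp add: ip_sum_right ip_scale_right)
  also have "\<dots> = (\<Sum>l<m. if k = l then h l else 0)"
    using assms by (intro sum.cong) (auto simp: orthonormal_rows_iff)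
  also have "\<dots> = h k" using assms(2) by simp
  finally show ?thesis .
qed

text \<open>The form is continuous and the frames, cut off to 0 outside the
  \<open>m \<times> N\<close> block, are compact: closed, with entries of modulus at most 1. The
  cut-off changes neither orthonormality nor the form, so the maximiser also beats frames that are
  not cut off.\<close>

lemma maximal_frame:
  assumes "m \<le> N"
  obtains V where "orthonormal_rows m N V" "\<forall>k. \<forall>j\<ge>N. V k j = 0"
    "\<forall>U. orthonormal_rows m N U \<longrightarrow>
      (\<Sum>k<m. re (ip N (U k) (matvec N B (U k)))) \<le> (\<Sum>k<m. re (ip N (V k) (matvec N B (V k))))"
proof -
  define q where "q V = (\<Sum>k<m. re (ip N (V k) (matvec N B (V k))))" for V
  define trunc where "trunc U = (\<lambda>k j. if k < m \<and> j < N then U k j else 0)" for U :: "nat \<Rightarrow> nat \<Rightarrow> 'k"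
  define S where "S = {V. orthonormal_rows m N V \<and> (\<forall>k j. (k \<ge> m \<or> j \<ge> N) \<longrightarrow> V k j = 0)}"
  have trunc_S: "trunc U \<in> S" if "orthonormal_rows m N U" for U
    using that unfolding S_def orthonormal_rows_def by (auto simp: trunc_def)
  have q_trunc: "q (trunc U) = q U" for U
    unfolding q_def
  proof (intro sum.cong refl arg_cong[of _ _ re] ip_cong)
    fix k i assume k: "k \<in> {..<m}"
    show "i < N \<Longrightarrow> trunc U k i = U k i" using k by (simp add: trunc_def)
    show "matvec N B (trunc U k) i = matvec N B (U k) i"
      using k by (intro fun_cong[OF matvec_cong]) (simp add: trunc_def)
  qed
  have "compact S"
  proof -
    define K where "K = Pi UNIV (\<lambda>_::nat. Pi UNIV (\<lambda>_::nat. cball (0::'k) 1))"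
    have "norm (V k j) \<le> 1" if V: "V \<in> S" for V k j
    proof (cases "k < m \<and> j < N")
      case True
      have "(norm (V k j))\<^sup>2 \<le> (\<Sum>j<N. (norm (V k j))\<^sup>2)"
        using True by (intro member_le_sum) auto
      also have "\<dots> = 1" using V True by (intro orthonormal_rows_norm) (auto simp: S_def)
      finally show ?thesis by (simp add: power_le_one_iff)
    next
      case False
      hence "V k j = 0" using V by (auto simp: S_def)
      thus ?thesis by simp
    qed
    hence "S = K \<inter> S" by (auto simp: K_def)
    moreover have "closed S"
      unfolding S_def orthonormal_rows_def
      by (intro closed_Collect_conj closed_Collect_all closed_Collect_imp open_Collect_const
          closed_Collect_eq continuous_intros)
    moreover have "compact K" unfolding K_def by (intro compact_Pi_UNIV compact_cball)
    ultimately show ?thesis using compact_Int_closed by metis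
  qed
  moreover have "S \<noteq> {}" using trunc_S orthonormal_rows_exists[OF assms] by blast
  moreover have "continuous_on S q"
    unfolding q_def ip_def matvec_def by (intro continuous_intros)
  ultimately have "\<exists>V\<in>S. \<forall>U\<in>S. q U \<le> q V" by (rule continuous_attains_sup)
  then obtain V where V: "V \<in> S" "\<forall>U\<in>S. q U \<le> q V" ..
  have "q U \<le> q V" if "orthonormal_rows m N U" for U
    using bspec[OF V(2) trunc_S[OF that]] by (simp only: q_trunc)
  moreover have "orthonormal_rows m N V" "\<forall>k. \<forall>j\<ge>N. V k j = 0" using V(1) by (auto simp: S_def)
  ultimately show thesis using that[of V] unfolding q_def by simp
qed

text \<open>First variation: replacing the vector \<open>V k\<close> of a maximising frame by the normalisation of
  \<open>V k + t z\<close>, with \<open>z\<close> the component of \<open>B (V k)\<close> orthogonal to the frame, changes the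
  functional by \<open>2 t \<parallel>z\<parallel>\<^sup>2\<close> to first order.\<close>

lemma maximal_frame_invariant:
  assumes herm: "\<And>i j. \<lbrakk>i < N; j < N\<rbrakk> \<Longrightarrow> B j i = cj (B i j)"
    and V: "orthonormal_rows m N V"
    and max: "\<forall>U. orthonormal_rows m N U \<longrightarrow>
      (\<Sum>k<m. re (ip N (U k) (matvec N B (U k)))) \<le> (\<Sum>k<m. re (ip N (V k) (matvec N B (V k))))"
    and k: "k < m" and i: "i < N"
  shows "matvec N B (V k) i = (\<Sum>l<m. ip N (V l) (matvec N B (V k)) * V l i)"
proof -
  define g where "g x = re (ip N x (matvec N B x))" for x
  define h where "h l = ip N (V l) (matvec N B (V k))" for l
  define z where "z i = matvec N B (V k) i - (\<Sum>l<m. h l * V l i)" for i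
  define n where "n = (\<Sum>i<N. (norm (z i))\<^sup>2)"
  have n0: "n \<ge> 0" unfolding n_def by (intro sum_nonneg) auto
  have zz: "ip N z z = of_real n" by (simp only: ip_self n_def)
  have Vz: "ip N (V l) z = 0" if l: "l < m" for l
  proof -
    have "ip N (V l) z = h l - ip N (V l) (\<lambda>i. \<Sum>l<m. h l * V l i)"
      unfolding z_def[abs_def] ip_diff_right by (simp add: h_def)
    thus ?thesis using ip_orthonormal_sum[OF V l] by simp
  qed
  have zV: "ip N z (V l) = 0" if l: "l < m" for l using cj_ip[of N "V l" z] Vz[OF l] by simp
  have VV: "ip N (V a) (V b) = (if a = b then 1 else 0)" if "a < m" "b < m" for a b
    using V that by (simp add: orthonormal_rows_iff)
  have zBV: "ip N z (matvec N B (V k)) = of_real n"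
  proof -
    \<comment> \<open>\<open>z\<close> is orthogonal to the frame, so of \<open>B (V k)\<close> it
      sees only the component \<open>z\<close>.\<close>
    have "ip N z z = ip N z (matvec N B (V k)) - (\<Sum>l<m. h l * ip N z (V l))"
      by (subst (2) z_def[abs_def]) (simp add: ip_diff_right ip_sum_right ip_scale_right)
    thus ?thesis using zV zz by simp
  qed
  have g_exp: "g (\<lambda>i. V k i + of_real t * z i) = g (V k) + 2 * t * n + t\<^sup>2 * g z" for t
  proof -
    have zBV': "ip N (V k) (matvec N B z) = of_real n"
      using ip_matvec[OF herm, where x = "V k" and y = z] cj_ip[of N z "matvec N B (V k)"] zBV by simp
    have "ip N (\<lambda>i. V k i + of_real t * z i) (matvec N B (\<lambda>i. V k i + of_real t * z i))
        = ip N (V k) (matvec N B (V k)) + of_real (2 * t * n) + of_real (t\<^sup>2) * ip N z (matvec N B z)"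
      unfolding matvec_add matvec_scale ip_add_left ip_add_right ip_scale_left ip_scale_right zBV zBV'
      by (simp add: algebra_simps power2_eq_square)
    thus ?thesis unfolding g_def by (simp only: re_add re_of_real re_scale)
  qed
  \<comment> \<open>Normalisation divides the form by \<open>r^2 = 1 + t^2 n\<close>, which is
    quadratic in \<open>t\<close> and cannot offset the linear gain \<open>2 t n\<close>. Dividing
    by \<open>t\<close> leaves a bound on \<open>n\<close> that tends to 0 with
    \<open>t\<close>.\<close>
  have key: "2 * n \<le> t * (n * g (V k) - g z)" if t: "t > 0" for t
  proof -
    define r where "r = sqrt (1 + t\<^sup>2 * n)"
    have r2: "r\<^sup>2 = 1 + t\<^sup>2 * n" unfolding r_def using n0 by (simp add: real_sqrt_pow2)
    have r: "r > 0" unfolding r_def using n0 by (simp add: add_pos_nonneg)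
    define y where "y i = V k i + of_real t * z i" for i
    define U where "U = V(k := (\<lambda>i. of_real (1 / r) * y i))"
    have yy: "ip N y y = of_real (r\<^sup>2)"
      unfolding y_def ip_add_left ip_add_right ip_scale_left ip_scale_right zz r2
      using VV[OF k k] Vz[OF k] zV[OF k] by (simp add: power2_eq_square)
    have Vy: "ip N (V l) y = 0" if "l < m" "l \<noteq> k" for l
      unfolding y_def ip_add_right ip_scale_right using VV[OF that(1) k] Vz[OF that(1)] that(2) by simp
    have yV: "ip N y (V l) = 0" if "l < m" "l \<noteq> k" for l using cj_ip[of N "V l" y] Vy[OF that] by simp
    have "orthonormal_rows m N U"
      unfolding orthonormal_rows_iff
    proof (intro allI impI)
      fix a b assume ab: "a < m" "b < m"
      have kk: "ip N (U k) (U k) = 1"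
      proof -
        have "ip N (U k) (U k) = of_real ((1 / r) * ((1 / r) * r\<^sup>2))"
          unfolding U_def fun_upd_same ip_scale_left ip_scale_right yy cj_of_real of_real_mult ..
        also have "(1 / r) * ((1 / r) * r\<^sup>2) = 1" using r by (simp add: power2_eq_square)
        finally show ?thesis by simp
      qed
      consider "a = k" "b = k" | "a = k" "b \<noteq> k" | "a \<noteq> k" "b = k" | "a \<noteq> k" "b \<noteq> k" by blast
      thus "ip N (U a) (U b) = (if a = b then 1 else 0)"
      proof cases
        case 1 thus ?thesis using kk by simp
      next
        case 2
        hence "ip N (U a) (U b) = cj (of_real (1 / r)) * ip N y (V b)"
          by (simp only: U_def fun_upd_same fun_upd_other ip_scale_left not_False_eq_True)
        thus ?thesis using 2 yV[of b] ab by simp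
      next
        case 3
        hence "ip N (U a) (U b) = of_real (1 / r) * ip N (V a) y"
          by (simp only: U_def fun_upd_same fun_upd_other ip_scale_right not_False_eq_True)
        thus ?thesis using 3 Vy[of a] ab by simp
      next
        case 4 thus ?thesis using VV ab by (simp add: U_def)
      qed
    qed
    hence "(\<Sum>l<m. g (U l)) \<le> (\<Sum>l<m. g (V l))" using max unfolding g_def by blast
    moreover have "(\<Sum>l<m. g (U l)) = g (U k) + (\<Sum>l\<in>{..<m} - {k}. g (U l))"
      "(\<Sum>l<m. g (V l)) = g (V k) + (\<Sum>l\<in>{..<m} - {k}. g (V l))"
      using k by (auto intro: sum.remove)
    moreover have "(\<Sum>l\<in>{..<m} - {k}. g (U l)) = (\<Sum>l\<in>{..<m} - {k}. g (V l))"
      by (intro sum.cong) (auto simp: U_def)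
    ultimately have "g (U k) \<le> g (V k)" by linarith
    moreover have "g (U k) = g y / r\<^sup>2"
    proof -
      have "ip N (U k) (matvec N B (U k)) = of_real (1 / r * (1 / r)) * ip N y (matvec N B y)"
        by (simp only: U_def fun_upd_same matvec_scale ip_scale_left ip_scale_right cj_of_real of_real_mult mult.assoc)
      hence "g (U k) = 1 / r * (1 / r) * g y" unfolding g_def by (simp only: re_scale)
      thus ?thesis by (simp add: power2_eq_square)
    qed
    ultimately have "g y \<le> g (V k) * r\<^sup>2" using r by (simp add: field_simps)
    hence "g (V k) + 2 * t * n + t\<^sup>2 * g z \<le> g (V k) * (1 + t\<^sup>2 * n)"
      unfolding r2 y_def g_exp .
    hence "t * (2 * n) \<le> t * (t * (n * g (V k) - g z))" by (simp add: algebra_simps power2_eq_square)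
    thus ?thesis using t by simp
  qed
  have "n \<le> 0"
  proof (rule ccontr)
    assume "\<not> n \<le> 0"
    define D where "D = n * g (V k) - g z"
    \<comment> \<open>This choice gives \<open>t * D \<le> n\<close>, contradicting
      \<open>2 * n \<le> t * D\<close> for positive \<open>n\<close>.\<close>
    define t where "t = n / (\<bar>D\<bar> + 1)"
    have t: "t > 0" unfolding t_def using \<open>\<not> n \<le> 0\<close> by (intro divide_pos_pos) auto
    have "2 * n \<le> t * D" using key[OF t] by (simp add: D_def)
    also have "\<dots> \<le> t * (\<bar>D\<bar> + 1)" using t by (intro mult_left_mono) auto
    also have "\<dots> = n" unfolding t_def by (simp add: add_nonneg_pos less_imp_neq[symmetric])
    finally show False using \<open>\<not> n \<le> 0\<close> by simp
  qed
  hence "n = 0" using n0 by simp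
  hence "\<forall>i\<in>{..<N}. (norm (z i))\<^sup>2 = 0"
    unfolding n_def by (subst (asm) sum_nonneg_eq_0_iff) auto
  hence "z i = 0" using i by simp
  thus ?thesis by (simp add: z_def h_def)
qed

end

text \<open>All dimensions share the value type of functions on \<open>nat\<close>; vanishing from
  \<open>N\<close> on keeps the norm definite. The inserted 0 gives \<open>Max\<close> a value when
  \<open>N = 0\<close>.\<close>

definition linf :: "nat \<Rightarrow> (nat \<Rightarrow> 'k::real_normed_field, 'k) nspace" where
  "linf N = \<lparr>ns_carrier = {x. \<forall>j\<ge>N. x j = 0}, ns_add = (\<lambda>x y j. x j + y j), ns_zero = (\<lambda>_. 0),
     ns_smult = (\<lambda>a x j. a * x j), ns_norm = (\<lambda>x. Max (insert 0 ((\<lambda>j. norm (x j)) ` {..<N})))\<rparr>"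

lemma linf_simps [simp]:
  "ns_carrier (linf N) = {x. \<forall>j\<ge>N. x j = 0}" "ns_add (linf N) x y = (\<lambda>j. x j + y j)"
  "ns_zero (linf N) = (\<lambda>_. 0)" "ns_smult (linf N) a x = (\<lambda>j. a * x j)"
  by (simp_all add: linf_def)

lemma linf_norm: "ns_norm (linf N) x = Max (insert 0 ((\<lambda>j. norm (x j)) ` {..<N}))"
  by (simp add: linf_def)

lemma linf_norm_le: "\<lbrakk>0 \<le> r; \<And>j. j < N \<Longrightarrow> norm (x j) \<le> r\<rbrakk> \<Longrightarrow> ns_norm (linf N) x \<le> r"
  unfolding linf_norm by (intro Max.boundedI) auto

lemma norm_le_linf_norm: "j < N \<Longrightarrow> norm (x j) \<le> ns_norm (linf N) x"
  unfolding linf_norm by (intro Max_ge) auto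

lemma linf_norm_nonneg: "0 \<le> ns_norm (linf N) x"
  unfolding linf_norm by (intro Max_ge) auto

lemma linf_norm_eq_0:
  assumes "x \<in> ns_carrier (linf N)"
  shows "ns_norm (linf N) x = 0 \<longleftrightarrow> x = (\<lambda>_. 0)"
proof
  assume n: "ns_norm (linf N) x = 0"
  have "x j = 0" for j
  proof (cases "j < N")
    case True
    hence "norm (x j) \<le> 0" using norm_le_linf_norm[of j N x] n by simp
    thus ?thesis by simp
  next
    case False
    thus ?thesis using assms by simp
  qed
  thus "x = (\<lambda>_. 0)" by blast
next
  assume "x = (\<lambda>_. 0)"
  hence "ns_norm (linf N) x \<le> 0" by (intro linf_norm_le) auto
  thus "ns_norm (linf N) x = 0" using linf_norm_nonneg[of N x] by linarith
qed

lemma linf_norm_smult: "ns_norm (linf N) (\<lambda>j. a * x j) = norm a * ns_norm (linf N) x"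
proof (rule antisym)
  show "ns_norm (linf N) (\<lambda>j. a * x j) \<le> norm a * ns_norm (linf N) x"
    by (intro linf_norm_le) (auto simp: norm_mult linf_norm_nonneg intro!: mult_left_mono norm_le_linf_norm)
  show "norm a * ns_norm (linf N) x \<le> ns_norm (linf N) (\<lambda>j. a * x j)"
  proof (cases "a = 0")
    case True thus ?thesis by (simp add: linf_norm_nonneg)
  next
    case False
    have "ns_norm (linf N) x \<le> ns_norm (linf N) (\<lambda>j. a * x j) / norm a"
    proof (rule linf_norm_le)
      fix j assume "j < N"
      hence "norm a * norm (x j) \<le> ns_norm (linf N) (\<lambda>j. a * x j)"
        using norm_le_linf_norm[of j N "\<lambda>j. a * x j"] by (simp add: norm_mult)
      thus "norm (x j) \<le> ns_norm (linf N) (\<lambda>j. a * x j) / norm a" using False by (simp add: field_simps)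
    qed (simp add: linf_norm_nonneg)
    thus ?thesis using False by (simp add: field_simps)
  qed
qed

lemma linf_complete:
  fixes s :: "nat \<Rightarrow> nat \<Rightarrow> 'k::{real_normed_field, complete_space}"
  assumes s: "\<forall>n. s n \<in> ns_carrier (linf N)"
    and cauchy: "\<forall>e>0. \<exists>K. \<forall>p\<ge>K. \<forall>q\<ge>K. ns_norm (linf N) (ns_diff (linf N) (s p) (s q)) < e"
  shows "\<exists>l\<in>ns_carrier (linf N). \<forall>e>0. \<exists>K. \<forall>n\<ge>K. ns_norm (linf N) (ns_diff (linf N) (s n) l) < e"
proof -
  have diff: "ns_diff (linf N) x y = (\<lambda>j. x j - y j)" for x y :: "nat \<Rightarrow> 'k"
    by (simp add: ns_diff_def)
  have "convergent (\<lambda>n. s n j)" if j: "j < N" for j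
  proof (rule Cauchy_convergent, rule metric_CauchyI)
    fix e :: real assume "e > 0"
    then obtain K where K: "\<forall>p\<ge>K. \<forall>q\<ge>K. ns_norm (linf N) (ns_diff (linf N) (s p) (s q)) < e"
      using cauchy by blast
    have "dist (s p j) (s q j) < e" if "p \<ge> K" "q \<ge> K" for p q
    proof -
      have "ns_norm (linf N) (\<lambda>j. s p j - s q j) < e" using K that unfolding diff by blast
      thus ?thesis using norm_le_linf_norm[OF j, of "\<lambda>j. s p j - s q j"] by (simp add: dist_norm)
    qed
    thus "\<exists>K. \<forall>p\<ge>K. \<forall>q\<ge>K. dist (s p j) (s q j) < e" by blast
  qed
  define l where "l j = (if j < N then lim (\<lambda>n. s n j) else 0)" for j
  have lim: "(\<lambda>n. s n j) \<longlonglongrightarrow> l j" if "j < N" for j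
    using \<open>\<And>j. j < N \<Longrightarrow> convergent (\<lambda>n. s n j)\<close>[OF that] that
    by (simp add: l_def convergent_LIMSEQ_iff)
  show ?thesis
  proof (intro bexI[of _ l] allI impI)
    show "l \<in> ns_carrier (linf N)" by (simp add: l_def)
    fix e :: real assume e: "e > 0"
    \<comment> \<open>Passing to the limit weakens the strict Cauchy estimate to
      \<open>\<le>\<close>; working with half of \<open>e\<close> restores strictness.\<close>
    hence "e / 2 > 0" by simp
    then obtain K where K: "\<forall>p\<ge>K. \<forall>q\<ge>K. ns_norm (linf N) (ns_diff (linf N) (s p) (s q)) < e / 2"
      using cauchy by blast
    have "ns_norm (linf N) (ns_diff (linf N) (s n) l) < e" if n: "n \<ge> K" for n
    proof -
      have "ns_norm (linf N) (\<lambda>j. s n j - l j) \<le> e / 2"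
      proof (rule linf_norm_le)
        fix j assume j: "j < N"
        have "norm (s n j - s q j) \<le> e / 2" if "q \<ge> K" for q
        proof -
          have "ns_norm (linf N) (\<lambda>j. s n j - s q j) < e / 2" using K n that unfolding diff by blast
          thus ?thesis using norm_le_linf_norm[OF j, of "\<lambda>j. s n j - s q j"] by linarith
        qed
        hence "\<forall>q\<ge>K. norm (s n j - s q j) \<le> e / 2" by blast
        moreover have "(\<lambda>q. norm (s n j - s q j)) \<longlonglongrightarrow> norm (s n j - l j)"
          by (intro tendsto_intros lim[OF j])
        ultimately show "norm (s n j - l j) \<le> e / 2"
          by (intro LIMSEQ_le_const2) auto
      qed (use e in simp)
      thus ?thesis unfolding diff using e by linarith
    qed
    thus "\<exists>K. \<forall>n\<ge>K. ns_norm (linf N) (ns_diff (linf N) (s n) l) < e" by blast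
  qed
qed

lemma is_banach_linf: "is_banach (linf N :: (nat \<Rightarrow> 'k::{real_normed_field, complete_space}, 'k) nspace)"
  unfolding is_banach_def Let_def
proof (intro conjI)
  show "\<forall>x\<in>ns_carrier (linf N). 0 \<le> ns_norm (linf N) x" by (simp add: linf_norm_nonneg)
  show "\<forall>x\<in>ns_carrier (linf N). (ns_norm (linf N) x = 0) = (x = ns_zero (linf N))"
    using linf_norm_eq_0 by auto
  show "\<forall>a. \<forall>x\<in>ns_carrier (linf N). ns_norm (linf N) (ns_smult (linf N) a x) = norm a * ns_norm (linf N) x"
    by (simp add: linf_norm_smult)
  show "\<forall>x\<in>ns_carrier (linf N). \<forall>y\<in>ns_carrier (linf N).
      ns_norm (linf N) (ns_add (linf N) x y) \<le> ns_norm (linf N) x + ns_norm (linf N) y"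
    by (auto intro!: linf_norm_le add_nonneg_nonneg linf_norm_nonneg
        order_trans[OF norm_triangle_ineq] add_mono norm_le_linf_norm)
  show "\<forall>s :: nat \<Rightarrow> nat \<Rightarrow> 'k. (\<forall>n. s n \<in> ns_carrier (linf N)) \<and>
      (\<forall>e>0. \<exists>K. \<forall>p\<ge>K. \<forall>q\<ge>K. ns_norm (linf N) (ns_diff (linf N) (s p) (s q)) < e) \<longrightarrow>
      (\<exists>l\<in>ns_carrier (linf N). \<forall>e>0. \<exists>K. \<forall>n\<ge>K. ns_norm (linf N) (ns_diff (linf N) (s n) l) < e)"
    by (intro allI impI, elim conjE) (rule linf_complete)
qed (auto simp: algebra_simps)

lemma lincomb_linf: "lincomb (linf N) c b n = (\<lambda>j. \<Sum>k<n. c k * b k j)"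
  by (induction n) simp_all

section \<open>Trace duality in \<open>linf N\<close>\<close>

context conj_field
begin

lemma norm_ip_le: "norm (ip N v x) \<le> (\<Sum>i<N. norm (v i)) * ns_norm (linf N) x"
proof -
  have "norm (ip N v x) \<le> (\<Sum>i<N. norm (cj (v i) * x i))" unfolding ip_def by (rule norm_sum)
  also have "\<dots> \<le> (\<Sum>i<N. norm (v i) * ns_norm (linf N) x)"
    by (intro sum_mono) (simp add: norm_mult mult_left_mono norm_le_linf_norm)
  finally show ?thesis by (simp add: sum_distrib_right)
qed

text \<open>The lower bound for \<open>\<parallel>P\<parallel>\<close> is trace duality: if the span of the frame is invariant under
  \<open>B\<close>, the trace of \<open>P B\<close> does not depend on the projection \<open>P\<close>.\<close>

lemma rel_proj_const_linf_ge:
  assumes N: "N \<ge> 1" and V: "orthonormal_rows m N V" and supp: "\<forall>k. \<forall>j\<ge>N. V k j = 0"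
    and B: "\<And>i j. \<lbrakk>i < N; j < N\<rbrakk> \<Longrightarrow> norm (B i j) \<le> 1"
    and inv: "\<And>k i. \<lbrakk>k < m; i < N\<rbrakk> \<Longrightarrow>
      matvec N B (V k) i = (\<Sum>l<m. ip N (V l) (matvec N B (V k)) * V l i)"
  defines "Y \<equiv> {lincomb (linf N) c V m | c. True}"
  shows "(\<Sum>k<m. re (ip N (V k) (matvec N B (V k)))) / real N \<le> rel_proj_const (linf N) Y"
proof -
  interpret conj_banach cj re "linf N :: (nat \<Rightarrow> 'k, 'k) nspace"
    by unfold_locales (rule is_banach_linf)
  have V_in: "V k \<in> ns_carrier (linf N)" for k using supp by simp
  have Y_coord: "y = lincomb (linf N) (\<lambda>k. ip N (V k) y) V m" if y: "y \<in> Y" for y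
  proof -
    obtain c where c: "y = lincomb (linf N) c V m" using y unfolding Y_def by blast
    have "ip N (V k) y = c k" if "k < m" for k
      unfolding c lincomb_linf by (rule ip_orthonormal_sum[OF V that])
    thus ?thesis by (subst (1) c) (intro lincomb_cong, simp)
  qed
  show ?thesis
    unfolding rel_proj_const_def
  proof (rule cInf_greatest)
    \<comment> \<open>The orthogonal projection witnesses that the infimum is taken over a nonempty
      set.\<close>
    have "is_proj (linf N) Y (\<lambda>x. lincomb (linf N) (\<lambda>k. ip N (V k) x) V m)"
      unfolding is_proj_def
    proof (intro conjI ballI allI)
      show "lincomb (linf N) (\<lambda>k. ip N (V k) x) V m \<in> Y" for x unfolding Y_def by blast
      show "lincomb (linf N) (\<lambda>k. ip N (V k) (ns_add (linf N) x y)) V m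
        = ns_add (linf N) (lincomb (linf N) (\<lambda>k. ip N (V k) x) V m) (lincomb (linf N) (\<lambda>k. ip N (V k) y) V m)" for x y
        by (simp add: lincomb_linf ip_add_right distrib_right sum.distrib)
      show "lincomb (linf N) (\<lambda>k. ip N (V k) (ns_smult (linf N) a x)) V m
        = ns_smult (linf N) a (lincomb (linf N) (\<lambda>k. ip N (V k) x) V m)" for a x
        by (simp add: lincomb_linf ip_scale_right sum_distrib_left mult.assoc)
      show "\<exists>C. \<forall>x\<in>ns_carrier (linf N).
          ns_norm (linf N) (lincomb (linf N) (\<lambda>k. ip N (V k) x) V m) \<le> C * ns_norm (linf N) x"
      proof (intro exI ballI)
        fix x :: "nat \<Rightarrow> 'k"
        have "ns_norm (linf N) (lincomb (linf N) (\<lambda>k. ip N (V k) x) V m)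
            \<le> (\<Sum>k<m. norm (ip N (V k) x) * ns_norm (linf N) (V k))"
          using V_in by (rule norm_lincomb_le)
        also have "\<dots> \<le> (\<Sum>k<m. (\<Sum>i<N. norm (V k i)) * ns_norm (linf N) x * ns_norm (linf N) (V k))"
          by (intro sum_mono mult_right_mono norm_ip_le linf_norm_nonneg)
        also have "\<dots> = (\<Sum>k<m. (\<Sum>i<N. norm (V k i)) * ns_norm (linf N) (V k)) * ns_norm (linf N) x"
          by (simp add: sum_distrib_left sum_distrib_right mult_ac)
        finally show "ns_norm (linf N) (lincomb (linf N) (\<lambda>k. ip N (V k) x) V m)
            \<le> (\<Sum>k<m. (\<Sum>i<N. norm (V k i)) * ns_norm (linf N) (V k)) * ns_norm (linf N) x" .
      qed
      show "lincomb (linf N) (\<lambda>k. ip N (V k) y) V m = y" if "y \<in> Y" for y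
        using Y_coord[OF that] by (rule sym)
    qed
    thus "op_norm (linf N) ` {P. is_proj (linf N) Y P} \<noteq> {}" by blast
  next
    fix r assume "r \<in> op_norm (linf N) ` {P. is_proj (linf N) Y P}"
    then obtain P where P: "is_proj (linf N) Y P" and r: "r = op_norm (linf N) P" by blast
    have P_Y: "P x \<in> Y" if "x \<in> ns_carrier (linf N)" for x using P that unfolding is_proj_def by blast
    have P_id: "P y = y" if "y \<in> Y" for y using P that unfolding is_proj_def by blast
    define \<phi> where "\<phi> k x = ip N (V k) (P x)" for k x
    have \<phi>: "klinear (\<phi> k)" for k
      unfolding klinear_def
    proof (intro conjI ballI allI)
      fix x y :: "nat \<Rightarrow> 'k" assume xy: "x \<in> ns_carrier (linf N)" "y \<in> ns_carrier (linf N)"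
      have "P (ns_add (linf N) x y) = ns_add (linf N) (P x) (P y)"
        using P xy unfolding is_proj_def by blast
      thus "\<phi> k (ns_add (linf N) x y) = \<phi> k x + \<phi> k y" unfolding \<phi>_def by (simp add: ip_add_right)
    next
      fix a and x :: "nat \<Rightarrow> 'k" assume x: "x \<in> ns_carrier (linf N)"
      have "P (ns_smult (linf N) a x) = ns_smult (linf N) a (P x)"
        using P x unfolding is_proj_def by blast
      thus "\<phi> k (ns_smult (linf N) a x) = a * \<phi> k x" unfolding \<phi>_def by (simp add: ip_scale_right)
    qed
    \<comment> \<open>\<open>\<beta> j\<close> is column \<open>j\<close> of \<open>B\<close>, a
      vector of the unit ball of \<open>linf N\<close> because the entries of \<open>B\<close> have
      modulus at most 1. The combination \<open>u k\<close> of these columns is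
      \<open>B (V k)\<close>, which lies in \<open>Y\<close> by invariance and is therefore fixed by
      \<open>P\<close>.\<close>
    define \<beta> where "\<beta> j i = (if i < N \<and> j < N then B i j else 0)" for j i
    have \<beta>_in: "\<beta> j \<in> ns_carrier (linf N)" for j by (simp add: \<beta>_def)
    have \<beta>_norm: "ns_norm (linf N) (\<beta> j) \<le> 1" for j
      using B by (intro linf_norm_le) (auto simp: \<beta>_def)
    define u where "u k = lincomb (linf N) (V k) \<beta> N" for k
    have u_eq: "u k i = matvec N B (V k) i" if "i < N" for k i
      using that by (simp add: u_def lincomb_linf matvec_def \<beta>_def mult.commute)
    have u_Y: "u k \<in> Y" if k: "k < m" for k
    proof -
      have "u k i = lincomb (linf N) (\<lambda>l. ip N (V l) (matvec N B (V k))) V m i" for i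
      proof (cases "i < N")
        case True
        thus ?thesis using u_eq inv[OF k] by (simp add: lincomb_linf)
      next
        case False
        thus ?thesis using supp by (simp add: u_def lincomb_linf \<beta>_def)
      qed
      thus ?thesis unfolding Y_def by blast
    qed
    \<comment> \<open>The left side is the trace of \<open>P B\<close>. Expanding
      \<open>P (\<beta> j)\<close> in the frame and exchanging the sums collects the columns into
      \<open>B (V k)\<close>, where \<open>P\<close> acts as the identity.\<close>
    have "(\<Sum>j<N. P (\<beta> j) j) = (\<Sum>j<N. \<Sum>k<m. \<phi> k (\<beta> j) * V k j)"
    proof (rule sum.cong[OF refl])
      fix j
      have "P (\<beta> j) = lincomb (linf N) (\<lambda>k. \<phi> k (\<beta> j)) V m"
        unfolding \<phi>_def by (rule Y_coord[OF P_Y[OF \<beta>_in]])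
      thus "P (\<beta> j) j = (\<Sum>k<m. \<phi> k (\<beta> j) * V k j)" by (simp add: lincomb_linf)
    qed
    also have "\<dots> = (\<Sum>k<m. \<Sum>j<N. V k j * \<phi> k (\<beta> j))"
      by (subst sum.swap) (simp add: mult.commute)
    also have "\<dots> = (\<Sum>k<m. \<phi> k (u k))"
      unfolding u_def using \<beta>_in by (simp only: klinear_lincomb[OF \<phi>])
    also have "\<dots> = (\<Sum>k<m. ip N (V k) (matvec N B (V k)))"
      by (intro sum.cong refl) (simp add: \<phi>_def P_id u_Y ip_cong[OF _ u_eq])
    finally have "(\<Sum>k<m. re (ip N (V k) (matvec N B (V k)))) = re (\<Sum>j<N. P (\<beta> j) j)"
      by (simp add: re_sum)
    also have "\<dots> \<le> norm (\<Sum>j<N. P (\<beta> j) j)" by (rule re_le_norm)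
    also have "\<dots> \<le> (\<Sum>j<N. norm (P (\<beta> j) j))" by (rule norm_sum)
    also have "\<dots> \<le> (\<Sum>j<N. r)"
    proof (rule sum_mono)
      fix j assume "j \<in> {..<N}"
      hence "norm (P (\<beta> j) j) \<le> ns_norm (linf N) (P (\<beta> j))" by (intro norm_le_linf_norm) simp
      also have "\<dots> \<le> r" unfolding r by (rule norm_le_op_norm[OF P \<beta>_in \<beta>_norm])
      finally show "norm (P (\<beta> j) j) \<le> r" .
    qed
    finally show "(\<Sum>k<m. re (ip N (V k) (matvec N B (V k)))) / real N \<le> r"
      using N by (simp add: field_simps)
  qed
qed

theorem less_mu_abs_imp_less_rel_proj_const:
  assumes m: "m \<ge> 1" and c: "c < mu_abs cj m"
  shows "\<exists>(X :: (nat \<Rightarrow> 'k, 'k) nspace) Y. is_banach X \<and> fin_subspace X Y m \<and> c < rel_proj_const X Y"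
proof -
  obtain N U where mN: "m \<le> N" and U: "orthonormal_rows m N U" and cU: "c < gram_mean m N U"
    by (rule less_mu_abs[OF c])
  have N: "N \<ge> 1" using m mN by simp
  define G where "G i j = (\<Sum>k<m. cj (U k i) * U k j)" for i j
  \<comment> \<open>Where \<open>G i j = 0\<close> the division yields 0, which still respects the
    Hermitian symmetry, the bound 1 and the identity
    \<open>B i j * G i j = norm (G i j)\<close>.\<close>
  define B where "B i j = cj (G i j) / of_real (norm (G i j))" for i j
  have GG: "cj (G i j) = G j i" for i j by (simp add: G_def cj_sum cj_mult mult.commute)
  have B_norm: "norm (B i j) \<le> 1" for i j by (simp add: B_def norm_divide)
  have herm: "B j i = cj (B i j)" for i j
  proof -
    have "norm (G j i) = norm (G i j)" using norm_cj[of "G i j"] GG by simp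
    thus ?thesis by (simp add: B_def cj_divide_of_real GG)
  qed
  have BG: "B i j * G i j = of_real (norm (G i j))" for i j
    by (cases "G i j = 0") (simp_all add: B_def cj_mult_self power2_eq_square)
  obtain V where V: "orthonormal_rows m N V" and supp: "\<forall>k. \<forall>j\<ge>N. V k j = 0"
    and max: "\<forall>U. orthonormal_rows m N U \<longrightarrow>
      (\<Sum>k<m. re (ip N (U k) (matvec N B (U k)))) \<le> (\<Sum>k<m. re (ip N (V k) (matvec N B (V k))))"
    by (rule maximal_frame[OF mN])
  define Y where "Y = {lincomb (linf N) c V m | c. True}"
  have "(\<Sum>k<m. ip N (U k) (matvec N B (U k))) = (\<Sum>k<m. \<Sum>i<N. \<Sum>j<N. B i j * (cj (U k i) * U k j))"
    by (simp add: ip_def matvec_def sum_distrib_left mult.left_commute)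
  also have "\<dots> = (\<Sum>i<N. \<Sum>k<m. \<Sum>j<N. B i j * (cj (U k i) * U k j))" by (rule sum.swap)
  also have "\<dots> = (\<Sum>i<N. \<Sum>j<N. \<Sum>k<m. B i j * (cj (U k i) * U k j))"
    by (intro sum.cong refl sum.swap)
  also have "\<dots> = (\<Sum>i<N. \<Sum>j<N. B i j * G i j)" by (simp add: G_def sum_distrib_left)
  also have "\<dots> = of_real (\<Sum>i<N. \<Sum>j<N. norm (G i j))" by (simp add: BG)
  finally have "(\<Sum>k<m. re (ip N (U k) (matvec N B (U k)))) = (\<Sum>i<N. \<Sum>j<N. norm (G i j))"
    by (simp only: re_sum[symmetric] re_of_real)
  hence "gram_mean m N U = (\<Sum>k<m. re (ip N (U k) (matvec N B (U k)))) / real N"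
    by (simp add: gram_mean_def G_def)
  also have "\<dots> \<le> (\<Sum>k<m. re (ip N (V k) (matvec N B (V k)))) / real N"
    using max U by (intro divide_right_mono) auto
  also have "\<dots> \<le> rel_proj_const (linf N) Y"
    unfolding Y_def
    by (rule rel_proj_const_linf_ge[OF N V supp B_norm maximal_frame_invariant[OF herm V max]])
  finally have "c < rel_proj_const (linf N) Y" using cU by simp
  moreover have "fin_subspace (linf N) Y m"
    unfolding fin_subspace_def
  proof (intro exI[of _ V] conjI allI impI)
    show "V i \<in> ns_carrier (linf N)" for i using supp by simp
    show "Y = {lincomb (linf N) c V m | c. True}" by (rule Y_def)
    fix c i assume c: "lincomb (linf N) c V m = ns_zero (linf N)" and i: "i < m"
    have "c i = ip N (V i) (lincomb (linf N) c V m)"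
      unfolding lincomb_linf by (rule ip_orthonormal_sum[OF V i, symmetric])
    also have "\<dots> = 0" unfolding c by (simp add: ip_def)
    finally show "c i = 0" .
  qed
  moreover have "is_banach (linf N :: (nat \<Rightarrow> 'k, 'k) nspace)" by (rule is_banach_linf)
  ultimately show ?thesis by blast
qed

end

text \<open>\<open>\<lambda>(m)\<close> is a supremum over all Banach spaces, which do not form a
  set over one type. Equality is therefore split into two halves: \<open>mu_abs\<close> bounds the
  relative constants for every value type, and no smaller number does, already for spaces of scalar
  sequences.\<close>

theorem theorem4:
  shows "(\<forall>m::nat. m \<ge> 1 \<longrightarrow>
            (\<forall>(X::('x, real) nspace) Y. is_banach X \<and> fin_subspace X Y m
                 \<longrightarrow> rel_proj_const X Y \<le> mu_abs (id::real \<Rightarrow> real) m) \<and>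
            (\<forall>c < mu_abs (id::real \<Rightarrow> real) m.
                 \<exists>(X::(nat \<Rightarrow> real, real) nspace) Y. is_banach X \<and> fin_subspace X Y m
                    \<and> c < rel_proj_const X Y)) \<and>
         (\<forall>m::nat. m \<ge> 1 \<longrightarrow>
            (\<forall>(X::('y, complex) nspace) Y. is_banach X \<and> fin_subspace X Y m
                 \<longrightarrow> rel_proj_const X Y \<le> mu_abs cnj m) \<and>
            (\<forall>c < mu_abs cnj m.
                 \<exists>(X::(nat \<Rightarrow> complex, complex) nspace) Y. is_banach X \<and> fin_subspace X Y m
                    \<and> c < rel_proj_const X Y))"
proof -
  interpret real: conj_field "id :: real \<Rightarrow> real" id by (rule conj_field_real)
  interpret complex: conj_field cnj Re by (rule conj_field_complex)
  have upper_real: "rel_proj_const X Y \<le> mu_abs (id::real \<Rightarrow> real) m"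
    if "m \<ge> 1" "is_banach X" "fin_subspace X Y m" for X :: "('x, real) nspace" and Y m
  proof -
    interpret conj_banach "id :: real \<Rightarrow> real" id X by unfold_locales (rule that)
    show ?thesis using that by (intro rel_proj_const_le_mu_abs)
  qed
  have upper_complex: "rel_proj_const X Y \<le> mu_abs cnj m"
    if "m \<ge> 1" "is_banach X" "fin_subspace X Y m" for X :: "('y, complex) nspace" and Y m
  proof -
    interpret conj_banach cnj Re X by unfold_locales (rule that)
    show ?thesis using that by (intro rel_proj_const_le_mu_abs)
  qed
  show ?thesis
    using upper_real upper_complex real.less_mu_abs_imp_less_rel_proj_const
      complex.less_mu_abs_imp_less_rel_proj_const by simp
qed

end
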